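(* Let $k$ be a field of characteristic zero, $K$ an algebraic function field over $k$, and $V$ a valuation ring of $K$ of rank 1. Let $\{R_i\mid i\in I\}$ be a directed system of normal local rings such that (a) $V=\bigcup_{i\in I}R_i$; (b) $I$ has a minimum $0$; (c) each $R_i$ is essentially of finite type over $k$ and has quotient field $K$; (d) if $i<j$ then $R_j$ dominates $R_i$. Let $p_i=p(\hat R_i)_\infty$ be the prime ideal of elements of infinite value in $\hat R_i$. Then the ring $\overline T=\bigcup_{i\in I}\hat R_i/p_i$ is a valuation ring.
   Context: $\hat R$ denotes the completion of a local ring $R$ at its maximal ideal $m_R$. For local rings $R\subset S$, $S$ dominates $R$ if $m_S\cap R=m_R$. Elements of infinite value. Let $\nu$ be the valuation of $V$, with value group $\Gamma\subset\mathbf R$. For a normal local ring $R$, essentially of finite type over $k$, with quotient field $K$ and dominated by $V$, $p(\hat R)_\infty$ is the prime ideal of all $f\in\hat R$ such that for a (equivalently, any) Cauchy sequence $\{f_n\}$ in $R$ converging to $f$ and every $\rho\in\Gamma$ one has $\nu(f_n)>\rho$ for $n\gg0$. For $i<j$ the natural inclusion $\hat R_i\to\hat R_j$ induces an inclusion $\hat R_i/p_i\to\hat R_j/p_j$; $\overline T$ is the direct limit (union) of the resulting directed system. *)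

theory Defs
  imports "HOL-Algebra.Algebra" "HOL-Library.Extended_Real"
begin

text \<open>
  Rings between the ground field and the function field \<open>K\<close> are represented by their carrier sets
  \<open>R \<subseteq> carrier K\<close>; the ring itself is \<open>K\<lparr>carrier := R\<rparr>\<close>.
\<close>

section \<open>Local, normal and valuation rings; function fields\<close>

text \<open>No Noetherian condition is included: it is automatic for rings essentially of finite type over
  a field.\<close>

definition local_ring :: "('a, 'b) ring_scheme \<Rightarrow> bool" where
  "local_ring R \<longleftrightarrow> cring R \<and> (\<exists>!M. maximalideal M R)"

definition max_ideal :: "('a, 'b) ring_scheme \<Rightarrow> 'a set" where
  "max_ideal R = (THE M. maximalideal M R)"

definition quotient_field_is :: "('a, 'b) ring_scheme \<Rightarrow> 'a set \<Rightarrow> bool" where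
  "quotient_field_is K R \<longleftrightarrow> field K \<and> subring R K \<and>
     (\<forall>x\<in>carrier K. \<exists>a\<in>R. \<exists>b\<in>R - {\<zero>\<^bsub>K\<^esub>}. x = a \<otimes>\<^bsub>K\<^esub> inv\<^bsub>K\<^esub> b)"

definition integral_over :: "('a, 'b) ring_scheme \<Rightarrow> 'a set \<Rightarrow> 'a \<Rightarrow> bool" where
  "integral_over K R x \<longleftrightarrow>
     (\<exists>p\<in>carrier (R [X]\<^bsub>K\<^esub>). p \<noteq> [] \<and> lead_coeff p = \<one>\<^bsub>K\<^esub> \<and> ring.eval K p x = \<zero>\<^bsub>K\<^esub>)"

definition normal_in :: "('a, 'b) ring_scheme \<Rightarrow> 'a set \<Rightarrow> bool" where
  "normal_in K R \<longleftrightarrow> (\<forall>x\<in>carrier K. integral_over K R x \<longrightarrow> x \<in> R)"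

text \<open>\<open>R\<close> is a localization \<open>W\<^sup>-\<^sup>1k[S]\<close> of a finitely generated \<open>k\<close>-subalgebra of \<open>K\<close>.\<close>

definition ess_finite_type :: "('a, 'b) ring_scheme \<Rightarrow> 'a set \<Rightarrow> 'a set \<Rightarrow> bool" where
  "ess_finite_type K k R \<longleftrightarrow>
     (\<exists>S W. finite S \<and> S \<subseteq> carrier K \<and> submonoid W K \<and>
        W \<subseteq> generate_ring K (k \<union> S) \<and> \<zero>\<^bsub>K\<^esub> \<notin> W \<and>
        R = {a \<otimes>\<^bsub>K\<^esub> inv\<^bsub>K\<^esub> w | a w. a \<in> generate_ring K (k \<union> S) \<and> w \<in> W})"

definition dominates :: "('a, 'b) ring_scheme \<Rightarrow> 'a set \<Rightarrow> 'a set \<Rightarrow> bool" where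
  "dominates K S R \<longleftrightarrow>
     R \<subseteq> S \<and> max_ideal (K\<lparr>carrier := S\<rparr>) \<inter> R = max_ideal (K\<lparr>carrier := R\<rparr>)"

definition algebraic_function_field :: "('a, 'b) ring_scheme \<Rightarrow> 'a set \<Rightarrow> bool" where
  "algebraic_function_field K k \<longleftrightarrow> field K \<and> subfield k K \<and>
     (\<exists>S. finite S \<and> S \<subseteq> carrier K \<and> generate_field K (k \<union> S) = carrier K)"

definition valuation_ring_of :: "('a, 'b) ring_scheme \<Rightarrow> 'a set \<Rightarrow> bool" where
  "valuation_ring_of K V \<longleftrightarrow> field K \<and> subring V K \<and>
     (\<forall>x\<in>carrier K - {\<zero>\<^bsub>K\<^esub>}. x \<in> V \<or> inv\<^bsub>K\<^esub> x \<in> V)"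

text \<open>For a ring not presented inside a field, the condition ``\<open>x\<close> or \<open>x\<^sup>-\<^sup>1\<close> lies in the ring'' is
  written out for \<open>x = a/b\<close> in the quotient field.\<close>

definition valuation_ring :: "('a, 'b) ring_scheme \<Rightarrow> bool" where
  "valuation_ring D \<longleftrightarrow> domain D \<and>
     (\<forall>a\<in>carrier D. \<forall>b\<in>carrier D. a divides\<^bsub>D\<^esub> b \<or> b divides\<^bsub>D\<^esub> a)"

lemma valuation_ring_of_iff:
  "valuation_ring_of K V \<longleftrightarrow> quotient_field_is K V \<and> valuation_ring (K\<lparr>carrier := V\<rparr>)"
  (is "?L \<longleftrightarrow> ?R")
proof
  assume L: ?L
  interpret field K using L by (simp add: valuation_ring_of_def)
  have V: "subring V K" and
    tot: "\<And>x. x \<in> carrier K \<Longrightarrow> x \<noteq> \<zero>\<^bsub>K\<^esub> \<Longrightarrow> x \<in> V \<or> inv\<^bsub>K\<^esub> x \<in> V"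
    using L by (auto simp: valuation_ring_of_def)
  have sub: "V \<subseteq> carrier K" using V by (simp add: subringE(1))
  have "\<exists>a\<in>V. \<exists>b\<in>V - {\<zero>\<^bsub>K\<^esub>}. x = a \<otimes>\<^bsub>K\<^esub> inv\<^bsub>K\<^esub> b" if x: "x \<in> carrier K" for x
  proof (cases "x \<in> V")
    case True
    then show ?thesis using x subringE(3)[OF V]
      by (intro bexI[of _ x] bexI[of _ "\<one>\<^bsub>K\<^esub>"]) auto
  next
    case False
    then have x0: "x \<noteq> \<zero>\<^bsub>K\<^esub>" using subringE(2)[OF V] by auto
    then have "inv\<^bsub>K\<^esub> x \<in> V" using tot x False by auto
    moreover have "inv\<^bsub>K\<^esub> x \<noteq> \<zero>\<^bsub>K\<^esub>" "inv\<^bsub>K\<^esub> (inv\<^bsub>K\<^esub> x) = x"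
      using x x0 field_Units
      by (auto simp: Units_inv_inv dest: Units_r_inv)
    ultimately show ?thesis using x subringE(3)[OF V]
      by (intro bexI[of _ "\<one>\<^bsub>K\<^esub>"] bexI[of _ "inv\<^bsub>K\<^esub> x"]) auto
  qed
  moreover have "a divides\<^bsub>K\<lparr>carrier := V\<rparr>\<^esub> b \<or> b divides\<^bsub>K\<lparr>carrier := V\<rparr>\<^esub> a"
    if a: "a \<in> V" and b: "b \<in> V" for a b
  proof (cases "a = \<zero>\<^bsub>K\<^esub> \<or> b = \<zero>\<^bsub>K\<^esub>")
    case True
    moreover have "a \<otimes>\<^bsub>K\<^esub> \<zero>\<^bsub>K\<^esub> = \<zero>\<^bsub>K\<^esub>" "b \<otimes>\<^bsub>K\<^esub> \<zero>\<^bsub>K\<^esub> = \<zero>\<^bsub>K\<^esub>" using a b sub by auto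
    ultimately show ?thesis using subringE(2)[OF V] by (fastforce simp: factor_def)
  next
    case False
    have ac: "a \<in> carrier K" "b \<in> carrier K" using a b sub by auto
    have U: "a \<in> Units K" "b \<in> Units K" using ac False field_Units by auto
    let ?x = "b \<otimes>\<^bsub>K\<^esub> inv\<^bsub>K\<^esub> a" and ?y = "a \<otimes>\<^bsub>K\<^esub> inv\<^bsub>K\<^esub> b"
    have xy: "?x \<in> carrier K" "?y \<in> carrier K" using U ac by auto
    have eq: "a \<otimes>\<^bsub>K\<^esub> ?x = b" "b \<otimes>\<^bsub>K\<^esub> ?y = a"
      using U ac by (metis Units_inv_closed Units_r_inv m_assoc m_comm r_one)+
    have "?x \<otimes>\<^bsub>K\<^esub> ?y = \<one>\<^bsub>K\<^esub>"
      using U ac eq xy by (metis Units_inv_closed Units_r_inv m_assoc m_comm)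
    then have "inv\<^bsub>K\<^esub> ?x = ?y" using xy by (metis comm_inv_char)
    moreover have "?x \<noteq> \<zero>\<^bsub>K\<^esub>" using eq(1) ac False by auto
    ultimately have "?x \<in> V \<or> ?y \<in> V" using tot[of ?x] xy by auto
    then show ?thesis using eq by (fastforce simp: factor_def)
  qed
  moreover have "domain (K\<lparr>carrier := V\<rparr>)"
    using V by (simp add: subring_is_domain)
  ultimately show ?R
    using field_axioms V by (simp add: quotient_field_is_def valuation_ring_def)
next
  assume R: ?R
  interpret field K using R by (simp add: quotient_field_is_def)
  have V: "subring V K" using R by (simp add: quotient_field_is_def)
  have sub: "V \<subseteq> carrier K" using V by (simp add: subringE(1))
  have "x \<in> V \<or> inv\<^bsub>K\<^esub> x \<in> V" if x: "x \<in> carrier K" "x \<noteq> \<zero>\<^bsub>K\<^esub>" for x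
  proof -
    obtain a b where ab: "a \<in> V" "b \<in> V" "b \<noteq> \<zero>\<^bsub>K\<^esub>" "x = a \<otimes>\<^bsub>K\<^esub> inv\<^bsub>K\<^esub> b"
      using R x unfolding quotient_field_is_def by fastforce
    have ac: "a \<in> carrier K" "b \<in> carrier K" using ab sub by auto
    have bU: "b \<in> Units K" using ac ab field_Units by auto
    have a0: "a \<noteq> \<zero>\<^bsub>K\<^esub>" using ab x bU by auto
    have aU: "a \<in> Units K" using ac a0 field_Units by auto
    from R ab consider c where "c \<in> V" "b = a \<otimes>\<^bsub>K\<^esub> c" | c where "c \<in> V" "a = b \<otimes>\<^bsub>K\<^esub> c"
      unfolding valuation_ring_def factor_def by fastforce
    then show ?thesis
    proof cases
      case 1
      have "c \<in> carrier K" using 1 sub by auto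
      then have "x \<otimes>\<^bsub>K\<^esub> c = \<one>\<^bsub>K\<^esub>"
        using ab ac bU 1(2)
        by (metis Units_inv_closed Units_r_inv m_assoc m_comm)
      then have "inv\<^bsub>K\<^esub> x = c" using x \<open>c \<in> carrier K\<close> by (metis comm_inv_char)
      then show ?thesis using 1 by simp
    next
      case 2
      have "c \<in> carrier K" using 2 sub by auto
      then have "x = c"
        using ab ac bU 2(2)
        by (metis Units_inv_closed Units_r_inv m_assoc m_comm r_one)
      then show ?thesis using 2 by simp
    qed
  qed
  then show ?L using field_axioms V by (auto simp: valuation_ring_of_def)
qed

text \<open>The rank of a valuation ring is its Krull dimension.\<close>

definition krull_dim :: "('a, 'b) ring_scheme \<Rightarrow> enat" where
  "krull_dim R =
     (SUP n\<in>{n. \<exists>P. (\<forall>i\<le>n. primeideal (P i) R) \<and> (\<forall>i<n. P i \<subset> P (Suc i))}. enat n)"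

text \<open>\<open>\<nu>\<close> is a valuation of \<open>K\<close>, with values in the reals and \<open>\<nu>(0) = \<infinity>\<close>, whose valuation ring
  is \<open>V\<close>; for \<open>V\<close> of rank one it is unique up to scaling by a positive real.\<close>

definition real_valuation_of :: "('a, 'b) ring_scheme \<Rightarrow> 'a set \<Rightarrow> ('a \<Rightarrow> ereal) \<Rightarrow> bool" where
  "real_valuation_of K V \<nu> \<longleftrightarrow>
     (\<forall>x\<in>carrier K. \<nu> x \<noteq> -\<infinity>) \<and>
     (\<forall>x\<in>carrier K. \<nu> x = \<infinity> \<longleftrightarrow> x = \<zero>\<^bsub>K\<^esub>) \<and>
     (\<forall>x\<in>carrier K. \<forall>y\<in>carrier K. \<nu> (x \<otimes>\<^bsub>K\<^esub> y) = \<nu> x + \<nu> y) \<and>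
     (\<forall>x\<in>carrier K. \<forall>y\<in>carrier K. min (\<nu> x) (\<nu> y) \<le> \<nu> (x \<oplus>\<^bsub>K\<^esub> y)) \<and>
     V = {x \<in> carrier K. 0 \<le> \<nu> x}"

definition value_group :: "('a, 'b) ring_scheme \<Rightarrow> ('a \<Rightarrow> ereal) \<Rightarrow> real set" where
  "value_group K \<nu> = {r. \<exists>x\<in>carrier K - {\<zero>\<^bsub>K\<^esub>}. \<nu> x = ereal r}"


section \<open>Completion of a local ring\<close>

definition max_power :: "('a, 'b) ring_scheme \<Rightarrow> nat \<Rightarrow> 'a set" where
  "max_power R N = max_ideal R [^]\<^bsub>ideals_set R\<^esub> N"

definition cauchy_seq :: "('a, 'b) ring_scheme \<Rightarrow> (nat \<Rightarrow> 'a) set" where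
  "cauchy_seq R = {s. (\<forall>n. s n \<in> carrier R) \<and>
     (\<forall>N. \<exists>n0. \<forall>m\<ge>n0. \<forall>n\<ge>n0. s m \<ominus>\<^bsub>R\<^esub> s n \<in> max_power R N)}"

definition null_seq :: "('a, 'b) ring_scheme \<Rightarrow> (nat \<Rightarrow> 'a) set" where
  "null_seq R = {s. (\<forall>n. s n \<in> carrier R) \<and> (\<forall>N. \<exists>n0. \<forall>n\<ge>n0. s n \<in> max_power R N)}"

definition cauchy_ring :: "('a, 'b) ring_scheme \<Rightarrow> (nat \<Rightarrow> 'a) ring" where
  "cauchy_ring R =
     \<lparr>carrier = cauchy_seq R,
      monoid.mult = (\<lambda>s t n. s n \<otimes>\<^bsub>R\<^esub> t n), monoid.one = (\<lambda>n. \<one>\<^bsub>R\<^esub>),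
      ring.zero = (\<lambda>n. \<zero>\<^bsub>R\<^esub>), ring.add = (\<lambda>s t n. s n \<oplus>\<^bsub>R\<^esub> t n)\<rparr>"

text \<open>An element \<open>f\<close> of the completion is a coset of Cauchy sequences, and \<open>s \<in> f\<close> says
  that the Cauchy sequence \<open>s\<close> converges to \<open>f\<close>.\<close>

definition completion :: "('a, 'b) ring_scheme \<Rightarrow> (nat \<Rightarrow> 'a) set ring" where
  "completion R = cauchy_ring R Quot null_seq R"

text \<open>The map of completions induced by an inclusion \<open>R \<subseteq> S\<close> of local rings with \<open>S\<close> dominating
  \<open>R\<close>: the limit in \<open>R\<close> of a Cauchy sequence is sent to its limit in \<open>S\<close>. (All members of the
  union coincide.)\<close>

definition completion_map :: "('a, 'b) ring_scheme \<Rightarrow> (nat \<Rightarrow> 'a) set \<Rightarrow> (nat \<Rightarrow> 'a) set" where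
  "completion_map S f = (\<Union>s\<in>f. null_seq S +>\<^bsub>cauchy_ring S\<^esub> s)"

definition p_inf :: "('a, 'b) ring_scheme \<Rightarrow> ('a \<Rightarrow> ereal) \<Rightarrow> 'a set \<Rightarrow> (nat \<Rightarrow> 'a) set set" where
  "p_inf K \<nu> R = {f \<in> carrier (completion (K\<lparr>carrier := R\<rparr>)).
     \<exists>s\<in>f. \<forall>\<rho>\<in>value_group K \<nu>. \<exists>n0. \<forall>n\<ge>n0. ereal \<rho> < \<nu> (s n)}"

definition bar_completion ::
    "('a, 'b) ring_scheme \<Rightarrow> ('a \<Rightarrow> ereal) \<Rightarrow> 'a set \<Rightarrow> (nat \<Rightarrow> 'a) set set ring" where
  "bar_completion K \<nu> R = completion (K\<lparr>carrier := R\<rparr>) Quot p_inf K \<nu> R"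

text \<open>The map on the quotients by \<open>p_inf\<close> induced by \<^const>\<open>completion_map\<close>.\<close>

definition bar_map ::
    "('a, 'b) ring_scheme \<Rightarrow> ('a \<Rightarrow> ereal) \<Rightarrow> 'a set \<Rightarrow> (nat \<Rightarrow> 'a) set set \<Rightarrow> (nat \<Rightarrow> 'a) set set"
  where
  "bar_map K \<nu> S F = (\<Union>f\<in>F. p_inf K \<nu> S +>\<^bsub>completion (K\<lparr>carrier := S\<rparr>)\<^esub>
                                completion_map (K\<lparr>carrier := S\<rparr>) f)"


section \<open>Direct limits of rings\<close>

text \<open>For a directed set \<open>I\<close>, rings \<open>A i\<close> and transition maps \<open>\<phi> i j : A i \<rightarrow> A j\<close> (\<open>i \<le> j\<close>), the
  direct limit consists of the classes of pairs \<open>(i, a)\<close>, \<open>a \<in> A i\<close>, where two pairs are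
  identified if they agree at some later stage. The operations are given by unions over all
  representatives, whose members coincide.\<close>

definition dirlim_class ::
    "'i::order set \<Rightarrow> ('i \<Rightarrow> ('x, 'y) ring_scheme) \<Rightarrow> ('i \<Rightarrow> 'i \<Rightarrow> 'x \<Rightarrow> 'x) \<Rightarrow> 'i \<Rightarrow> 'x \<Rightarrow> ('i \<times> 'x) set"
  where
  "dirlim_class I A \<phi> i a =
     {(j, b). j \<in> I \<and> b \<in> carrier (A j) \<and> (\<exists>k\<in>I. i \<le> k \<and> j \<le> k \<and> \<phi> i k a = \<phi> j k b)}"

definition dirlim_op ::
    "'i::order set \<Rightarrow> ('i \<Rightarrow> ('x, 'y) ring_scheme) \<Rightarrow> ('i \<Rightarrow> 'i \<Rightarrow> 'x \<Rightarrow> 'x) \<Rightarrow>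
      ('i \<Rightarrow> 'x \<Rightarrow> 'x \<Rightarrow> 'x) \<Rightarrow> ('i \<times> 'x) set \<Rightarrow> ('i \<times> 'x) set \<Rightarrow> ('i \<times> 'x) set"
  where
  "dirlim_op I A \<phi> f B C =
     (\<Union>(i, a)\<in>B. \<Union>(j, b)\<in>C. \<Union>k\<in>{k \<in> I. i \<le> k \<and> j \<le> k}.
        dirlim_class I A \<phi> k (f k (\<phi> i k a) (\<phi> j k b)))"

definition direct_limit ::
    "'i::order set \<Rightarrow> ('i \<Rightarrow> ('x, 'y) ring_scheme) \<Rightarrow> ('i \<Rightarrow> 'i \<Rightarrow> 'x \<Rightarrow> 'x) \<Rightarrow> ('i \<times> 'x) set ring"
  where
  "direct_limit I A \<phi> =
     \<lparr>carrier = {dirlim_class I A \<phi> i a | i a. i \<in> I \<and> a \<in> carrier (A i)},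
      monoid.mult = dirlim_op I A \<phi> (\<lambda>i. monoid.mult (A i)),
      monoid.one = (\<Union>i\<in>I. dirlim_class I A \<phi> i \<one>\<^bsub>A i\<^esub>),
      ring.zero = (\<Union>i\<in>I. dirlim_class I A \<phi> i \<zero>\<^bsub>A i\<^esub>),
      ring.add = dirlim_op I A \<phi> (\<lambda>i. ring.add (A i))\<rparr>"

definition T_bar ::
    "('a, 'b) ring_scheme \<Rightarrow> ('a \<Rightarrow> ereal) \<Rightarrow> 'i::order set \<Rightarrow> ('i \<Rightarrow> 'a set) \<Rightarrow>
      ('i \<times> (nat \<Rightarrow> 'a) set set) set ring"
  where
  "T_bar K \<nu> I R =
     direct_limit I (\<lambda>i. bar_completion K \<nu> (R i)) (\<lambda>i j. bar_map K \<nu> (R j))"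

end

theory Submission
  imports Defs
begin

text \<open>
  Write \<open>C\<^sub>i\<close> for the completion of \<open>R\<^sub>i\<close>. The valuation \<open>\<nu>\<close> extends to every \<open>C\<^sub>i/p\<^sub>i\<close>, and the
  theorem says that these rings together already contain all quotients of nonnegative value. What makes this true is that, far enough along
  the system, every element of \<open>C\<^sub>i\<close> of finite value becomes an element of \<open>K\<close> times a unit. Let
  \<open>s\<close> be a Cauchy sequence in \<open>R\<^sub>i\<close> that does not have infinite value. As \<open>R\<^sub>i\<close> is Noetherian, its
  maximal ideal is finitely generated, so \<open>\<nu>\<close> is bounded below on it by some \<open>c > 0\<close>, and hence by
  \<open>N c\<close> on its \<open>N\<close>th power. Infinitely many terms of \<open>s\<close> have value below a fixed bound;
  so for large \<open>N\<close> there are arbitrarily late terms \<open>a\<close> of \<open>s\<close> with \<open>\<nu>(a) < N c\<close>. The finitely many generators of that power, divided by \<open>a\<close>, have positive value, so they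
  lie in \<open>V\<close> and therefore in a common \<open>R\<^sub>l\<close>, indeed in its maximal ideal. The later terms of \<open>s\<close>
  differ from \<open>a\<close> by elements of the \<open>N\<close>th power; so \<open>s = a u\<close> from there on, where \<open>u\<close> is
  a Cauchy sequence of units of \<open>R\<^sub>l\<close>. Two such sequences \<open>a u\<close> and \<open>b v\<close> compare as \<open>a\<close> and \<open>b\<close>
  do, and one of \<open>b/a\<close>, \<open>a/b\<close> lies in \<open>V\<close>, hence in some \<open>R\<^sub>j\<close>. So one divides the other in the
  limit. Also \<open>s t\<close> has the finite value \<open>\<nu>(a) + \<nu>(b)\<close>, which makes the limit a domain.

  Sequences are used in place of cosets throughout. The Cauchy sequences of the \<open>R\<^sub>i\<close> form an
  increasing family of subrings of the ring of all sequences in \<open>K\<close>. Let \<open>D\<close> be their union and \<open>P\<close>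
  the set of sequences whose values tend to infinity. Completing, factoring out \<open>p\<^sub>i\<close> and passing to
  the limit amounts to mapping \<open>D\<close> onto the limit with kernel \<open>P \<inter> D\<close>
  (\<open>quot_class_eq_iff\<close>, \<open>limit_class_eq_iff\<close>), so all statements about the limit reduce to
  statements about sequences modulo \<open>P\<close>.

  The Noetherian property comes from Hilbert's basis theorem (\<open>simple_extension_noetherian\<close>), the
  units from \<open>max_ideal_eq\<close>, which identifies the maximal ideal of \<open>R\<^sub>i\<close> with the elements of positive
  value, and the rank of \<open>V\<close> enters through the existence of an element of positive value:
  it makes the value group unbounded, so that ``infinite value'' means \<open>\<nu>(s\<^sub>n) \<rightarrow> \<infinity>\<close>.
\<close>

section \<open>Ideals of subrings\<close>

lemma (in cring) ideal_subringI:
  assumes A: "subring A R" and "J \<subseteq> A" "\<zero> \<in> J"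
    and add: "\<And>a b. \<lbrakk>a \<in> J; b \<in> J\<rbrakk> \<Longrightarrow> a \<oplus> b \<in> J"
    and mult: "\<And>a b. \<lbrakk>a \<in> A; b \<in> J\<rbrakk> \<Longrightarrow> a \<otimes> b \<in> J"
  shows "ideal J (R\<lparr>carrier := A\<rparr>)"
proof -
  interpret A: ring "R\<lparr>carrier := A\<rparr>" using A by (rule subring_is_ring)
  have J: "J \<subseteq> carrier R" using assms(2) subringE(1)[OF A] by blast
  have "\<ominus>\<^bsub>R\<lparr>carrier := A\<rparr>\<^esub> a \<in> J" if "a \<in> J" for a
  proof -
    have "a \<in> A" using that assms(2) by blast
    then have "\<ominus>\<^bsub>R\<lparr>carrier := A\<rparr>\<^esub> a = (\<ominus>\<^bsub>R\<lparr>carrier := A\<rparr>\<^esub> \<one>) \<otimes> a"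
      using A.l_minus[of \<one> a] A.l_one[of a] A.one_closed by simp
    moreover have "\<ominus>\<^bsub>R\<lparr>carrier := A\<rparr>\<^esub> \<one> \<in> A"
      using A.a_inv_closed[of \<one>] A.one_closed by simp
    ultimately show ?thesis using mult that by metis
  qed
  then have "subgroup J (add_monoid (R\<lparr>carrier := A\<rparr>))"
    by (intro subgroup.intro) (simp_all add: assms(2,3) add a_inv_def)
  moreover have "a \<otimes> x \<in> J" if "a \<in> J" "x \<in> A" for a x
    using mult[OF that(2,1)] m_comm[of a x] that J subringE(1)[OF A] by (metis subsetD)
  ultimately show ?thesis using mult A.ring_axioms by (intro idealI) auto
qed

lemma (in cring) ideal_subringE:
  assumes A: "subring A R" and J: "ideal J (R\<lparr>carrier := A\<rparr>)"
  shows "J \<subseteq> A" "\<zero> \<in> J"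
    and "\<And>a b. \<lbrakk>a \<in> J; b \<in> J\<rbrakk> \<Longrightarrow> a \<oplus> b \<in> J"
    and "\<And>a b. \<lbrakk>a \<in> A; b \<in> J\<rbrakk> \<Longrightarrow> a \<otimes> b \<in> J"
    and "\<And>a. a \<in> J \<Longrightarrow> \<ominus> a \<in> J"
proof -
  interpret J: ideal J "R\<lparr>carrier := A\<rparr>" by fact
  show "J \<subseteq> A" using J.a_subset by simp
  show "\<zero> \<in> J" using additive_subgroup.zero_closed[OF J.is_additive_subgroup] by simp
  show "\<And>a b. \<lbrakk>a \<in> J; b \<in> J\<rbrakk> \<Longrightarrow> a \<oplus> b \<in> J" using additive_subgroup.a_closed[OF J.is_additive_subgroup] by simp
  show mult: "\<And>a b. \<lbrakk>a \<in> A; b \<in> J\<rbrakk> \<Longrightarrow> a \<otimes> b \<in> J" using J.I_l_closed by simp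
  fix a assume a: "a \<in> J"
  have "a \<in> carrier R" using a \<open>J \<subseteq> A\<close> subringE(1)[OF A] by blast
  then have "\<ominus> a = (\<ominus> \<one>) \<otimes> a" by (simp add: l_minus)
  then show "\<ominus> a \<in> J" using mult[OF subringE(5)[OF A subringE(3)[OF A]] a] by simp
qed

lemma (in cring) ideal_inter_subring:
  assumes A: "subring A R" and B: "subring B R" and "A \<subseteq> B"
    and J: "ideal J (R\<lparr>carrier := B\<rparr>)"
  shows "ideal (J \<inter> A) (R\<lparr>carrier := A\<rparr>)"
  using assms(3) ideal_subringE[OF B J] subringE(2,6,7)[OF A]
  by (intro ideal_subringI A) auto

section \<open>Hilbert's basis theorem for subrings\<close>

text \<open>The values at \<open>x\<close> of the polynomials of degree less than \<open>n\<close> over \<open>A\<close>. As \<open>x\<close> may be algebraic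
  over \<open>A\<close>, one element can be such a value in several ways; working with values instead of
  polynomials keeps everything inside the ambient ring.\<close>

primrec (in ring) polys_below :: "'a set \<Rightarrow> 'a \<Rightarrow> nat \<Rightarrow> 'a set" where
  "polys_below A x 0 = {\<zero>}"
| "polys_below A x (Suc n) = {p \<oplus> a \<otimes> x [^] n | p a. p \<in> polys_below A x n \<and> a \<in> A}"

text \<open>All leading coefficients of degree \<open>n\<close>, over all representations of elements of \<open>J\<close>. Zero is
  allowed, which makes these sets ideals of \<open>A\<close>.\<close>

definition (in ring) leading_coeffs :: "'a set \<Rightarrow> 'a \<Rightarrow> 'a set \<Rightarrow> nat \<Rightarrow> 'a set" where
  "leading_coeffs A x J n = {a \<in> A. \<exists>p\<in>polys_below A x n. p \<oplus> a \<otimes> x [^] n \<in> J}"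

context cring
begin

context
  fixes A x
  assumes A: "subring A R" and x: "x \<in> carrier R"
begin

lemma A_carrier: "a \<in> A \<Longrightarrow> a \<in> carrier R"
  using subringE(1)[OF A] by blast

lemma polys_below_closed: "p \<in> polys_below A x n \<Longrightarrow> p \<in> carrier R"
  by (induction n arbitrary: p) (auto simp: A_carrier x)

lemma zero_polys_below: "\<zero> \<in> polys_below A x n"
proof (induction n)
  case (Suc n)
  then have "\<zero> \<oplus> \<zero> \<otimes> x [^] n \<in> polys_below A x (Suc n)"
    using subringE(2)[OF A] by auto
  then show ?case using x by simp
qed simp

lemma polys_below_add:
  "\<lbrakk>p \<in> polys_below A x n; q \<in> polys_below A x n\<rbrakk> \<Longrightarrow> p \<oplus> q \<in> polys_below A x n"
proof (induction n arbitrary: p q)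
  case (Suc n)
  then obtain p' a q' b where pq: "p = p' \<oplus> a \<otimes> x [^] n" "q = q' \<oplus> b \<otimes> x [^] n"
    "p' \<in> polys_below A x n" "q' \<in> polys_below A x n" "a \<in> A" "b \<in> A" by auto
  have "p \<oplus> q = (p' \<oplus> q') \<oplus> (a \<oplus> b) \<otimes> x [^] n"
    unfolding pq(1,2)
    using polys_below_closed[OF pq(3)] polys_below_closed[OF pq(4)] A_carrier[OF pq(5)]
      A_carrier[OF pq(6)] nat_pow_closed[OF x, of n]
    by algebra
  moreover have "p' \<oplus> q' \<in> polys_below A x n" "a \<oplus> b \<in> A"
    using Suc.IH pq subringE(7)[OF A] by auto
  ultimately show ?case by auto
qed simp

lemma polys_below_smult:
  "\<lbrakk>c \<in> A; p \<in> polys_below A x n\<rbrakk> \<Longrightarrow> c \<otimes> p \<in> polys_below A x n"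
proof (induction n arbitrary: p)
  case (Suc n)
  then obtain p' a where p: "p = p' \<oplus> a \<otimes> x [^] n" "p' \<in> polys_below A x n" "a \<in> A" by auto
  have "c \<otimes> p = c \<otimes> p' \<oplus> (c \<otimes> a) \<otimes> x [^] n"
    unfolding p(1) using polys_below_closed[OF p(2)] A_carrier[OF p(3)] A_carrier[OF Suc.prems(1)]
      nat_pow_closed[OF x, of n]
    by algebra
  moreover have "c \<otimes> p' \<in> polys_below A x n" "c \<otimes> a \<in> A"
    using Suc p subringE(6)[OF A] by auto
  ultimately show ?case by auto
qed (auto simp: A_carrier)

lemma polys_below_shift:
  "p \<in> polys_below A x n \<Longrightarrow> p \<otimes> x \<in> polys_below A x (Suc n)"
proof (induction n arbitrary: p)
  case 0
  then show ?case using zero_polys_below[of 1] x by simp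
next
  case (Suc n)
  then obtain p' a where p: "p = p' \<oplus> a \<otimes> x [^] n" "p' \<in> polys_below A x n" "a \<in> A" by auto
  have "p \<otimes> x = p' \<otimes> x \<oplus> a \<otimes> x [^] Suc n"
    unfolding p(1) nat_pow_Suc
    using x polys_below_closed[OF p(2)] A_carrier[OF p(3)] nat_pow_closed[OF x, of n]
    by algebra
  then show ?case using Suc.IH[OF p(2)] p(3) by (subst polys_below.simps(2)) blast
qed

lemma const_polys_below: "a \<in> A \<Longrightarrow> a \<in> polys_below A x (Suc n)"
proof (induction n)
  case 0
  then have "\<zero> \<oplus> a \<otimes> x [^] (0::nat) \<in> polys_below A x (Suc 0)" by auto
  then show ?case using 0 A_carrier by simp
next
  case (Suc n)
  then have "a \<oplus> \<zero> \<otimes> x [^] Suc n \<in> polys_below A x (Suc (Suc n))"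
    using subringE(2)[OF A] by (subst polys_below.simps(2)) blast
  then show ?case using Suc A_carrier x by (simp del: polys_below.simps)
qed

lemma simple_extension_polys_below:
  "y \<in> simple_extension A x \<Longrightarrow> \<exists>n. y \<in> polys_below A x n"
proof (induction rule: simple_extension.induct)
  case zero
  then show ?case by (auto intro: exI[of _ 0])
next
  case (lin p a)
  then show ?case
    using polys_below_add polys_below_shift const_polys_below by meson
qed

end

end

text \<open>The leading coefficients increase with the degree because an element of \<open>J\<close> can be multiplied
  by \<open>x\<close>.\<close>

lemma (in domain) leading_coeffs_ideal:
  assumes A: "subring A R" and x: "x \<in> carrier R"
    and J: "ideal J (R\<lparr>carrier := simple_extension A x\<rparr>)"
  shows "ideal (leading_coeffs A x J n) (R\<lparr>carrier := A\<rparr>)"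
    and "leading_coeffs A x J n \<subseteq> leading_coeffs A x J (Suc n)"
proof -
  let ?B = "simple_extension A x"
  have B: "subring ?B R" using simple_extension_is_subring[OF A x] .
  have AB: "A \<subseteq> ?B" using simple_extension_incl subringE(1)[OF A] x by blast
  have xB: "x \<in> ?B" using simple_extension_mem[OF A x] .
  note Jc = ideal_subringE[OF B J]
  note Ac = subringE(1)[OF A, THEN subsetD] 
  note pc = polys_below_closed[OF A x]
  note xn = nat_pow_closed[OF x, of n]
  show "ideal (leading_coeffs A x J n) (R\<lparr>carrier := A\<rparr>)"
  proof (rule ideal_subringI[OF A])
    show "\<zero> \<in> leading_coeffs A x J n"
      unfolding leading_coeffs_def using zero_polys_below[OF A x] Jc(2) subringE(2)[OF A] xn
      by (auto intro!: bexI[of _ \<zero>])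
  next
    fix a b assume "a \<in> leading_coeffs A x J n" "b \<in> leading_coeffs A x J n"
    then obtain p q where pq: "a \<in> A" "b \<in> A" "p \<in> polys_below A x n" "q \<in> polys_below A x n"
      "p \<oplus> a \<otimes> x [^] n \<in> J" "q \<oplus> b \<otimes> x [^] n \<in> J" unfolding leading_coeffs_def by auto
    have "(p \<oplus> a \<otimes> x [^] n) \<oplus> (q \<oplus> b \<otimes> x [^] n) = (p \<oplus> q) \<oplus> (a \<oplus> b) \<otimes> x [^] n"
      using pc[OF pq(3)] pc[OF pq(4)] Ac[OF pq(1)] Ac[OF pq(2)] xn by algebra
    then have "(p \<oplus> q) \<oplus> (a \<oplus> b) \<otimes> x [^] n \<in> J" using Jc(3)[OF pq(5,6)] by simp
    then show "a \<oplus> b \<in> leading_coeffs A x J n"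
      unfolding leading_coeffs_def using polys_below_add[OF A x] pq subringE(7)[OF A] by blast
  next
    fix c a assume c: "c \<in> A" and "a \<in> leading_coeffs A x J n"
    then obtain p where p: "a \<in> A" "p \<in> polys_below A x n"
      "p \<oplus> a \<otimes> x [^] n \<in> J" unfolding leading_coeffs_def by auto
    have "c \<otimes> (p \<oplus> a \<otimes> x [^] n) = c \<otimes> p \<oplus> (c \<otimes> a) \<otimes> x [^] n"
      using pc[OF p(2)] Ac[OF p(1)] Ac[OF c] xn by algebra
    then have "c \<otimes> p \<oplus> (c \<otimes> a) \<otimes> x [^] n \<in> J" using Jc(4)[of c, OF _ p(3)] AB c by auto
    then show "c \<otimes> a \<in> leading_coeffs A x J n"
      unfolding leading_coeffs_def using polys_below_smult[OF A x] p c subringE(6)[OF A] by blast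
  qed (simp add: leading_coeffs_def)
  show "leading_coeffs A x J n \<subseteq> leading_coeffs A x J (Suc n)"
  proof
    fix a assume "a \<in> leading_coeffs A x J n"
    then obtain p where p: "a \<in> A" "p \<in> polys_below A x n"
      "p \<oplus> a \<otimes> x [^] n \<in> J" unfolding leading_coeffs_def by auto
    have "x \<otimes> (p \<oplus> a \<otimes> x [^] n) = p \<otimes> x \<oplus> a \<otimes> x [^] Suc n"
      unfolding nat_pow_Suc using pc[OF p(2)] Ac[OF p(1)] x xn by algebra
    then have "p \<otimes> x \<oplus> a \<otimes> x [^] Suc n \<in> J" using Jc(4)[OF xB p(3)] by simp
    then show "a \<in> leading_coeffs A x J (Suc n)"
      unfolding leading_coeffs_def using polys_below_shift[OF A x p(2)] p(1) by blast
  qed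
qed

text \<open>An element of \<open>J\<close> can be lowered in degree by subtracting an element of \<open>J'\<close> with the same leading
  coefficient; after finitely many steps nothing is left.\<close>

lemma (in domain) ideal_eq_if_leading_coeffs_le:
  assumes A: "subring A R" and x: "x \<in> carrier R"
    and J: "ideal J (R\<lparr>carrier := simple_extension A x\<rparr>)"
    and J': "ideal J' (R\<lparr>carrier := simple_extension A x\<rparr>)"
    and "J' \<subseteq> J"
    and le: "\<And>n. leading_coeffs A x J n \<subseteq> leading_coeffs A x J' n"
  shows "J = J'"
proof -
  let ?B = "simple_extension A x"
  have B: "subring ?B R" using simple_extension_is_subring[OF A x] .
  note Jc = ideal_subringE[OF B J]
  note J'c = ideal_subringE[OF B J']
  have "y \<in> J \<Longrightarrow> y \<in> polys_below A x n \<Longrightarrow> y \<in> J'" for y n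
  proof (induction n arbitrary: y)
    case 0
    then show ?case using J'c(2) by simp
  next
    case (Suc n)
    then obtain p a where p: "y = p \<oplus> a \<otimes> x [^] n" "p \<in> polys_below A x n" "a \<in> A" by auto
    then have "a \<in> leading_coeffs A x J' n"
      using le Suc.prems(1) unfolding leading_coeffs_def by blast
    then obtain q where q: "q \<in> polys_below A x n" "q \<oplus> a \<otimes> x [^] n \<in> J'"
      unfolding leading_coeffs_def by auto
    have c: "p \<in> carrier R" "q \<in> carrier R" "a \<in> carrier R" "x [^] n \<in> carrier R"
      using polys_below_closed[OF A x] p q x subringE(1)[OF A] by auto
    have eq: "y \<oplus> \<ominus> (q \<oplus> a \<otimes> x [^] n) = p \<oplus> (\<ominus> \<one>) \<otimes> q"
      unfolding p(1) using c by algebra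
    have "\<ominus> \<one> \<in> A" using subringE(3,5)[OF A] by blast
    then have "p \<oplus> (\<ominus> \<one>) \<otimes> q \<in> polys_below A x n"
      using polys_below_add[OF A x p(2)] polys_below_smult[OF A x] q(1) by blast
    moreover have "p \<oplus> (\<ominus> \<one>) \<otimes> q \<in> J"
      unfolding eq[symmetric] using Jc(3,5) Suc.prems(1) q(2) assms(5) by blast
    ultimately have "y \<oplus> \<ominus> (q \<oplus> a \<otimes> x [^] n) \<in> J'" using Suc.IH eq by simp
    then have "(y \<oplus> \<ominus> (q \<oplus> a \<otimes> x [^] n)) \<oplus> (q \<oplus> a \<otimes> x [^] n) \<in> J'" using J'c(3) q(2) by blast
    then show ?case unfolding p(1) using c by (simp add: a_assoc l_neg)
  qed
  moreover have "\<exists>n. y \<in> polys_below A x n" if "y \<in> J" for y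
    using simple_extension_polys_below[OF A x] Jc(1) that by blast
  ultimately show ?thesis using assms(5) by blast
qed

text \<open>The leading coefficient ideals of \<open>J\<close> form an increasing chain in the Noetherian ring \<open>A\<close>, so they
  are constant from some degree \<open>N\<close> on. Finitely many elements of \<open>J\<close> realize generators of the
  first \<open>N + 1\<close> of them, and these elements generate an ideal with the same leading coefficients as
  \<open>J\<close>.\<close>

theorem (in domain) simple_extension_noetherian:
  assumes A: "subring A R" and x: "x \<in> carrier R"
    and noeth: "noetherian_ring (R\<lparr>carrier := A\<rparr>)"
  shows "noetherian_ring (R\<lparr>carrier := simple_extension A x\<rparr>)"
proof -
  let ?B = "simple_extension A x"
  have B: "subring ?B R" using simple_extension_is_subring[OF A x] .
  interpret A: noetherian_ring "R\<lparr>carrier := A\<rparr>" by fact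
  interpret B: ring "R\<lparr>carrier := ?B\<rparr>" using B by (rule subring_is_ring)
  show ?thesis
  proof (rule B.noetherian_ringI)
    fix J assume J: "ideal J (R\<lparr>carrier := ?B\<rparr>)"
    note Jc = ideal_subringE[OF B J]
    note lc_ideal = leading_coeffs_ideal(1)[OF A x]
    have lc_mono: "leading_coeffs A x J' n \<subseteq> leading_coeffs A x J' m"
      if "ideal J' (R\<lparr>carrier := ?B\<rparr>)" "n \<le> m" for J' m n
      using lift_Suc_mono_le[of "leading_coeffs A x J'"] leading_coeffs_ideal(2)[OF A x that(1)] that(2)
      by blast
    \<comment> \<open>Quantifying over all \<open>J'\<close> that contain \<open>G\<close> lets the sets for different degrees be united.\<close>
    have gen: "\<exists>G. finite G \<and> G \<subseteq> J \<and>
        (\<forall>J'. ideal J' (R\<lparr>carrier := ?B\<rparr>) \<and> G \<subseteq> J' \<longrightarrow>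
          leading_coeffs A x J n \<subseteq> leading_coeffs A x J' n)" for n
    proof -
      obtain S where S: "S \<subseteq> A" "finite S" "leading_coeffs A x J n = Idl\<^bsub>R\<lparr>carrier := A\<rparr>\<^esub> S"
        using A.finetely_gen[OF lc_ideal[OF J, of n]] by auto
      have "\<forall>a\<in>S. \<exists>p\<in>polys_below A x n. p \<oplus> a \<otimes> x [^] n \<in> J"
        using A.genideal_self[of S] S unfolding leading_coeffs_def by auto
      then obtain f where f: "\<And>a. a \<in> S \<Longrightarrow> f a \<in> polys_below A x n \<and> f a \<oplus> a \<otimes> x [^] n \<in> J"
        by metis
      show ?thesis
      proof (intro exI conjI allI impI)
        show "finite ((\<lambda>a. f a \<oplus> a \<otimes> x [^] n) ` S)" using S by simp
        show "(\<lambda>a. f a \<oplus> a \<otimes> x [^] n) ` S \<subseteq> J" using f by blast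
        fix J' assume J': "ideal J' (R\<lparr>carrier := ?B\<rparr>) \<and> (\<lambda>a. f a \<oplus> a \<otimes> x [^] n) ` S \<subseteq> J'"
        then have "S \<subseteq> leading_coeffs A x J' n"
          using f S(1) unfolding leading_coeffs_def by fast
        then show "leading_coeffs A x J n \<subseteq> leading_coeffs A x J' n"
          unfolding S(3) using A.genideal_minimal[OF lc_ideal] J' by blast
      qed
    qed
    then obtain G where G: "\<And>n. finite (G n)" "\<And>n. G n \<subseteq> J"
      "\<And>n J'. \<lbrakk>ideal J' (R\<lparr>carrier := ?B\<rparr>); G n \<subseteq> J'\<rbrakk> \<Longrightarrow>
          leading_coeffs A x J n \<subseteq> leading_coeffs A x J' n" by metis
    have "subset.chain {I. ideal I (R\<lparr>carrier := A\<rparr>)} (range (leading_coeffs A x J))"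
      unfolding pred_on.chain_def using lc_ideal[OF J] lc_mono[OF J]
      by (auto simp: subset_iff psubset_eq) (metis nat_le_linear subsetD)+
    then obtain N where N: "\<Union> (range (leading_coeffs A x J)) = leading_coeffs A x J N"
      using A.ideal_chain_is_trivial[of "range (leading_coeffs A x J)"] by auto
    define S where "S = (\<Union>n\<le>N. G n)"
    have S: "finite S" "S \<subseteq> J" using G unfolding S_def by auto
    then have SB: "S \<subseteq> carrier (R\<lparr>carrier := ?B\<rparr>)" using Jc(1) by auto
    let ?J' = "Idl\<^bsub>R\<lparr>carrier := ?B\<rparr>\<^esub> S"
    have J': "ideal ?J' (R\<lparr>carrier := ?B\<rparr>)" using B.genideal_ideal[OF SB] .
    have low: "leading_coeffs A x J n \<subseteq> leading_coeffs A x ?J' n" if "n \<le> N" for n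
    proof (rule G(3)[OF J'])
      show "G n \<subseteq> ?J'" using B.genideal_self[OF SB] that unfolding S_def by blast
    qed
    have "leading_coeffs A x J n \<subseteq> leading_coeffs A x ?J' n" for n
    proof (cases "n \<le> N")
      case False
      have "leading_coeffs A x J n \<subseteq> leading_coeffs A x J N" using N by blast
      also have "\<dots> \<subseteq> leading_coeffs A x ?J' N" using low by simp
      also have "\<dots> \<subseteq> leading_coeffs A x ?J' n" using lc_mono[OF J'] False by simp
      finally show ?thesis .
    qed (rule low)
    then have "J = ?J'"
      using ideal_eq_if_leading_coeffs_le[OF A x J J'] B.genideal_minimal[OF J S(2)] by blast
    then show "\<exists>S\<subseteq>carrier (R\<lparr>carrier := ?B\<rparr>). finite S \<and> J = Idl\<^bsub>R\<lparr>carrier := ?B\<rparr>\<^esub> S"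
      using S SB by blast
  qed
qed

lemma (in field) subfield_noetherian:
  assumes "subfield k R"
  shows "noetherian_ring (R\<lparr>carrier := k\<rparr>)"
proof -
  interpret k: field "R\<lparr>carrier := k\<rparr>" using assms subfield_iff(2) by blast
  show ?thesis
  proof (rule k.noetherian_ringI)
    fix J assume "ideal J (R\<lparr>carrier := k\<rparr>)"
    then have "J = {\<zero>} \<or> J = k" using k.all_ideals by auto
    then have "J = Idl\<^bsub>R\<lparr>carrier := k\<rparr>\<^esub> {\<zero>} \<or> J = Idl\<^bsub>R\<lparr>carrier := k\<rparr>\<^esub> {\<one>}"
      using k.genideal_zero k.genideal_one by auto
    moreover have "{\<zero>} \<subseteq> k" "{\<one>} \<subseteq> k" using k.zero_closed k.one_closed by auto
    ultimately show "\<exists>S\<subseteq>carrier (R\<lparr>carrier := k\<rparr>). finite S \<and> J = Idl\<^bsub>R\<lparr>carrier := k\<rparr>\<^esub> S"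
      by (metis finite.emptyI finite.insertI partial_object.select_convs(1) partial_object.surjective partial_object.update_convs(1))
  qed
qed

lemma (in field) generate_ring_noetherian:
  assumes k: "subfield k R" and "finite S" "S \<subseteq> carrier R"
  shows "noetherian_ring (R\<lparr>carrier := generate_ring R (k \<union> S)\<rparr>)"
  using assms(2,3)
proof (induction S)
  case empty
  have "generate_ring R k = k"
    using generate_ring_min_subring1[OF _ subfieldE(1)[OF k]] subfieldE(3)[OF k]
      generate_ring.incl[of _ k R] by blast
  then show ?case using subfield_noetherian[OF k] by simp
next
  case (insert x S)
  have kS: "k \<union> S \<subseteq> carrier R" "k \<union> insert x S \<subseteq> carrier R"
    using insert.prems subfieldE(3)[OF k] by auto
  let ?A = "generate_ring R (k \<union> S)"
  have A: "subring ?A R" using generate_ring_is_subring[OF kS(1)] .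
  have x: "x \<in> carrier R" using insert.prems by simp
  have "generate_ring R (k \<union> insert x S) = simple_extension ?A x"
  proof
    have "k \<union> insert x S \<subseteq> simple_extension ?A x"
      using simple_extension_mem[OF A x] simple_extension_incl[OF subringE(1)[OF A] x]
        generate_ring.incl[of _ "k \<union> S" R] by blast
    then show "generate_ring R (k \<union> insert x S) \<subseteq> simple_extension ?A x"
      using generate_ring_min_subring1[OF kS(2) simple_extension_is_subring[OF A x]] by blast
    have "?A \<subseteq> generate_ring R (k \<union> insert x S)"
      using generate_ring_min_subring1[OF kS(1) generate_ring_is_subring[OF kS(2)]]
        generate_ring.incl[of _ "k \<union> insert x S" R] by blast
    then show "simple_extension ?A x \<subseteq> generate_ring R (k \<union> insert x S)"
      using simple_extension_subring_incl[OF generate_ring_is_subring[OF kS(2)]]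
        generate_ring.incl[of x "k \<union> insert x S" R] by blast
  qed
  then show ?case using simple_extension_noetherian[OF A x] insert by simp
qed

text \<open>Every ideal of a localization is generated by its elements without denominators.\<close>

lemma (in field) ess_finite_type_noetherian:
  assumes k: "subfield k R" and A: "subring A R" and "ess_finite_type R k A"
  shows "noetherian_ring (R\<lparr>carrier := A\<rparr>)"
proof -
  obtain S W where S: "finite S" "S \<subseteq> carrier R" and W: "submonoid W R"
    "W \<subseteq> generate_ring R (k \<union> S)" "\<zero> \<notin> W"
    and A_eq: "A = {a \<otimes> inv w | a w. a \<in> generate_ring R (k \<union> S) \<and> w \<in> W}"
    using assms(3) unfolding ess_finite_type_def by auto
  let ?B = "generate_ring R (k \<union> S)"
  have B: "subring ?B R" using generate_ring_is_subring subfieldE(3)[OF k] S(2) by auto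
  interpret B: noetherian_ring "R\<lparr>carrier := ?B\<rparr>" using generate_ring_noetherian[OF k S] .
  interpret A: ring "R\<lparr>carrier := A\<rparr>" using A by (rule subring_is_ring)
  have one: "\<one> \<in> W" using W(1) by (simp add: submonoid_def)
  have BA: "?B \<subseteq> A"
  proof
    fix b assume "b \<in> ?B"
    then have "b = b \<otimes> inv \<one>" using subringE(1)[OF B] by auto
    then show "b \<in> A" unfolding A_eq using \<open>b \<in> ?B\<close> one by blast
  qed
  have WU: "w \<in> carrier R" "w \<in> Units R" "inv w \<in> A" if "w \<in> W" for w
  proof -
    show w: "w \<in> carrier R" using that W subringE(1)[OF B] by blast
    then show u: "w \<in> Units R" using that W(3) field_Units by auto
    then have "inv w = \<one> \<otimes> inv w" by simp
    then show "inv w \<in> A" unfolding A_eq using that subringE(3)[OF B] by blast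
  qed
  show ?thesis
  proof (rule A.noetherian_ringI)
    fix J assume J: "ideal J (R\<lparr>carrier := A\<rparr>)"
    note Jc = ideal_subringE[OF A J]
    obtain G where G: "G \<subseteq> ?B" "finite G" "J \<inter> ?B = Idl\<^bsub>R\<lparr>carrier := ?B\<rparr>\<^esub> G"
      using B.finetely_gen[OF ideal_inter_subring[OF B A BA J]] by auto
    have GJ: "G \<subseteq> J" using B.genideal_self[of G] G by auto
    have GA: "G \<subseteq> carrier (R\<lparr>carrier := A\<rparr>)" using G BA by auto
    let ?J' = "Idl\<^bsub>R\<lparr>carrier := A\<rparr>\<^esub> G"
    have J': "ideal ?J' (R\<lparr>carrier := A\<rparr>)" using A.genideal_ideal[OF GA] .
    have "y \<in> ?J'" if y: "y \<in> J" for y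
    proof -
      obtain b w where bw: "b \<in> ?B" "w \<in> W" "y = b \<otimes> inv w" using y Jc(1) A_eq by blast
      have bc: "b \<in> carrier R" using bw(1) subringE(1)[OF B] by blast
      have "w \<otimes> y = b" unfolding bw(3) using WU[OF bw(2)] bc by (simp add: m_lcomm)
      then have "b \<in> J \<inter> ?B" using Jc(4)[of w y] y bw W(2) BA by auto
      moreover have "Idl\<^bsub>R\<lparr>carrier := ?B\<rparr>\<^esub> G \<subseteq> ?J' \<inter> ?B"
        using B.genideal_minimal[OF ideal_inter_subring[OF B A BA J']] A.genideal_self[OF GA] G(1)
        by blast
      ultimately have "b \<in> ?J'" using G(3) by blast
      then have "inv w \<otimes> b \<in> ?J'" using ideal_subringE(4)[OF A J'] WU[OF bw(2)] by blast
      then show ?thesis unfolding bw(3) using m_comm bc WU[OF bw(2)] by simp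
    qed
    then have "J = ?J'" using A.genideal_minimal[OF J GJ] by blast
    then show "\<exists>S\<subseteq>carrier (R\<lparr>carrier := A\<rparr>). finite S \<and> J = Idl\<^bsub>R\<lparr>carrier := A\<rparr>\<^esub> S"
      using G(2) GA by blast
  qed
qed

section \<open>Local subrings and their Cauchy sequences\<close>

lemma (in noetherian_ring) proper_ideal_le_maximal:
  assumes J: "ideal J R" "J \<noteq> carrier R"
  shows "\<exists>M. maximalideal M R \<and> J \<subseteq> M"
proof -
  let ?S = "{I. ideal I R \<and> J \<subseteq> I \<and> I \<noteq> carrier R}"
  have "\<exists>M\<in>?S. \<forall>Y\<in>?S. M \<subseteq> Y \<longrightarrow> Y = M"
  proof (rule subset_Zorn)
    fix C assume C: "subset.chain ?S C"
    show "\<exists>U\<in>?S. \<forall>Y\<in>C. Y \<subseteq> U"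
    proof (cases "C = {}")
      case True
      then show ?thesis using J by blast
    next
      case False
      have "C \<subseteq> ?S" and "subset.chain {I. ideal I R} C"
        using C by (auto simp: pred_on.chain_def)
      then have "\<Union>C \<in> C" using ideal_chain_is_trivial[OF False] by simp
      then have "\<Union>C \<in> ?S" using \<open>C \<subseteq> ?S\<close> by (rule rev_subsetD)
      then show ?thesis by (rule bexI[rotated]) (simp add: Union_upper)
    qed
  qed
  then obtain M where M0: "M \<in> ?S" and max: "\<forall>Y\<in>?S. M \<subseteq> Y \<longrightarrow> Y = M" by (rule bexE)
  have M: "ideal M R" "J \<subseteq> M" "M \<noteq> carrier R" using M0 by simp_all
  have "maximalideal M R"
  proof (rule maximalidealI)
    fix Y assume "ideal Y R" "M \<subseteq> Y"
    then show "Y = M \<or> Y = carrier R" using max[rule_format, of Y] M(2) by auto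
  qed (use M in auto)
  then show ?thesis using M(2) by auto
qed

lemma (in ring) a_inv_subring:
  assumes "subring A R" "a \<in> A"
  shows "\<ominus>\<^bsub>R\<lparr>carrier := A\<rparr>\<^esub> a = \<ominus> a"
  using add.m_inv_consistent[OF subring.axioms(1)[OF assms(1)] assms(2)]
  by (simp add: a_inv_def)

lemma (in ring) a_minus_subring:
  assumes "subring A R" "a \<in> A" "b \<in> A"
  shows "a \<ominus>\<^bsub>R\<lparr>carrier := A\<rparr>\<^esub> b = a \<ominus> b"
  using a_inv_subring assms by (simp add: a_minus_def)

text \<open>A local ring \<open>A\<close> inside \<open>R\<close>, with the powers of its maximal ideal. Sums and products are those of
  \<open>R\<close>, so that local rings contained in one another can be compared.\<close>

locale local_subring = cring R for R (structure) +
  fixes A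
  assumes subring: "subring A R"
    and local_ring: "local_ring (R\<lparr>carrier := A\<rparr>)"
begin

abbreviation "\<mm> \<equiv> max_ideal (R\<lparr>carrier := A\<rparr>)"
abbreviation "mpow \<equiv> max_power (R\<lparr>carrier := A\<rparr>)"

sublocale A: cring "R\<lparr>carrier := A\<rparr>"
  using local_ring by (simp add: local_ring_def)

lemma A_carrier: "a \<in> A \<Longrightarrow> a \<in> carrier R"
  using subringE(1)[OF subring] by blast

lemma maximalideal: "maximalideal \<mm> (R\<lparr>carrier := A\<rparr>)"
  using local_ring theI'[of "\<lambda>M. maximalideal M (R\<lparr>carrier := A\<rparr>)"]
  unfolding local_ring_def max_ideal_def by blast

lemma maximal_unique: "maximalideal M (R\<lparr>carrier := A\<rparr>) \<Longrightarrow> M = \<mm>"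
  using local_ring maximalideal unfolding local_ring_def by blast

lemma mm_ideal: "ideal \<mm> (R\<lparr>carrier := A\<rparr>)"
  using maximalideal by (simp add: maximalideal_def)

lemma one_notin_mm: "\<one> \<notin> \<mm>"
  using ideal.one_imp_carrier[OF mm_ideal] maximalideal.I_notcarr[OF maximalideal] by auto

sublocale ideals: comm_monoid "ideals_set (R\<lparr>carrier := A\<rparr>)"
  by (rule A.ideals_set_is_comm_monoid)

lemma mpow_carrier: "mpow n \<in> carrier (ideals_set (R\<lparr>carrier := A\<rparr>))"
  unfolding max_power_def by (rule ideals.nat_pow_closed) (simp add: ideals_set_def mm_ideal)

lemma mpow_ideal: "ideal (mpow n) (R\<lparr>carrier := A\<rparr>)"
  using mpow_carrier[of n] by (simp add: ideals_set_def)

lemma mpow_0: "mpow 0 = A"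
  unfolding max_power_def by (simp add: ideals_set_def)

lemma mpow_Suc: "mpow (Suc n) = mpow n \<cdot>\<^bsub>R\<lparr>carrier := A\<rparr>\<^esub> \<mm>"
  unfolding max_power_def by (simp add: ideals_set_def)

lemma mpow_add: "mpow (n + m) = mpow n \<cdot>\<^bsub>R\<lparr>carrier := A\<rparr>\<^esub> mpow m"
proof -
  have "\<mm> \<in> carrier (ideals_set (R\<lparr>carrier := A\<rparr>))" by (simp add: ideals_set_def mm_ideal)
  from ideals.nat_pow_mult[OF this, of n m] show ?thesis
    unfolding max_power_def by (simp add: ideals_set_def)
qed

lemmas mpow_closed = ideal_subringE[OF subring mpow_ideal]

lemma mpow_minus: "\<lbrakk>a \<in> mpow n; b \<in> mpow n\<rbrakk> \<Longrightarrow> a \<ominus> b \<in> mpow n"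
  using mpow_closed(3,5) by (simp add: a_minus_def)

abbreviation "cauchy \<equiv> cauchy_seq (R\<lparr>carrier := A\<rparr>)"
abbreviation "null \<equiv> null_seq (R\<lparr>carrier := A\<rparr>)"

lemma cauchyI:
  assumes "\<And>n. s n \<in> A" "\<And>N. \<exists>n0. \<forall>m\<ge>n0. \<forall>n\<ge>n0. s m \<ominus> s n \<in> mpow N"
  shows "s \<in> cauchy"
  using assms a_minus_subring[OF subring] unfolding cauchy_seq_def by simp

lemma cauchyD:
  assumes "s \<in> cauchy"
  shows "s n \<in> A" "\<exists>n0. \<forall>m\<ge>n0. \<forall>n\<ge>n0. s m \<ominus> s n \<in> mpow N"
  using assms a_minus_subring[OF subring] unfolding cauchy_seq_def by auto

end

definition seq_ring :: "('a, 'b) ring_scheme \<Rightarrow> (nat \<Rightarrow> 'a) ring" where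
  "seq_ring R =
     \<lparr>carrier = {s. \<forall>n. s n \<in> carrier R},
      monoid.mult = (\<lambda>s t n. s n \<otimes>\<^bsub>R\<^esub> t n), monoid.one = (\<lambda>n. \<one>\<^bsub>R\<^esub>),
      ring.zero = (\<lambda>n. \<zero>\<^bsub>R\<^esub>), ring.add = (\<lambda>s t n. s n \<oplus>\<^bsub>R\<^esub> t n)\<rparr>"

lemma seq_ring_simps [simp]:
  "s \<in> carrier (seq_ring R) \<longleftrightarrow> (\<forall>n. s n \<in> carrier R)"
  "s \<otimes>\<^bsub>seq_ring R\<^esub> t = (\<lambda>n. s n \<otimes>\<^bsub>R\<^esub> t n)"
  "s \<oplus>\<^bsub>seq_ring R\<^esub> t = (\<lambda>n. s n \<oplus>\<^bsub>R\<^esub> t n)"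
  "\<one>\<^bsub>seq_ring R\<^esub> = (\<lambda>n. \<one>\<^bsub>R\<^esub>)"
  "\<zero>\<^bsub>seq_ring R\<^esub> = (\<lambda>n. \<zero>\<^bsub>R\<^esub>)"
  by (simp_all add: seq_ring_def)

lemma (in cring) seq_ring_cring: "cring (seq_ring R)"
proof (rule cringI)
  show "abelian_group (seq_ring R)"
  proof (rule abelian_groupI)
    fix s assume s: "s \<in> carrier (seq_ring R)"
    show "\<exists>t\<in>carrier (seq_ring R). t \<oplus>\<^bsub>seq_ring R\<^esub> s = \<zero>\<^bsub>seq_ring R\<^esub>"
      using s by (intro bexI[of _ "\<lambda>n. \<ominus> s n"]) (auto simp: l_neg)
  qed (auto simp: a_assoc a_comm a_lcomm)
  show "comm_monoid (seq_ring R)"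
    by (rule comm_monoidI) (auto simp: m_assoc m_comm m_lcomm)
qed (auto simp: l_distr)

lemma (in cring) seq_ring_a_inv [simp]:
  assumes "s \<in> carrier (seq_ring R)" shows "\<ominus>\<^bsub>seq_ring R\<^esub> s = (\<lambda>n. \<ominus> s n)"
proof -
  interpret S: cring "seq_ring R" by (rule seq_ring_cring)
  show ?thesis
    by (rule S.minus_equality) (use assms in \<open>auto simp: l_neg\<close>)
qed

lemma (in cring) seq_ring_minus [simp]:
  assumes "s \<in> carrier (seq_ring R)" "t \<in> carrier (seq_ring R)"
  shows "s \<ominus>\<^bsub>seq_ring R\<^esub> t = (\<lambda>n. s n \<ominus> t n)"
  using assms by (simp add: a_minus_def)

context local_subring begin

lemma cauchy_ring_eq: "cauchy_ring (R\<lparr>carrier := A\<rparr>) = (seq_ring R)\<lparr>carrier := cauchy\<rparr>"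
  by (simp add: cauchy_ring_def seq_ring_def)

lemma cauchy_carrier: "cauchy \<subseteq> carrier (seq_ring R)"
  using cauchyD(1) A_carrier by auto

lemma const_cauchy: "a \<in> A \<Longrightarrow> (\<lambda>n. a) \<in> cauchy"
  using mpow_closed(2) A_carrier by (intro cauchyI) (auto simp: r_neg a_minus_def)

lemma cauchy_mult:
  assumes "s \<in> cauchy" "t \<in> cauchy" shows "(\<lambda>n. s n \<otimes> t n) \<in> cauchy"
proof (rule cauchyI)
  note sA = cauchyD(1)[OF assms(1)] and tA = cauchyD(1)[OF assms(2)]
  show "s n \<otimes> t n \<in> A" for n using sA tA subringE(6)[OF subring] by blast
  fix N
  obtain n1 n2 where n: "\<forall>m\<ge>n1. \<forall>n\<ge>n1. s m \<ominus> s n \<in> mpow N" "\<forall>m\<ge>n2. \<forall>n\<ge>n2. t m \<ominus> t n \<in> mpow N"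
    using cauchyD(2)[OF assms(1), of N] cauchyD(2)[OF assms(2), of N] by blast
  have "s m \<otimes> t m \<ominus> s n \<otimes> t n \<in> mpow N" if "m \<ge> max n1 n2" "n \<ge> max n1 n2" for m n
  proof -
    have "s m \<otimes> t m \<ominus> s n \<otimes> t n = s m \<otimes> (t m \<ominus> t n) \<oplus> t n \<otimes> (s m \<ominus> s n)"
      using sA[THEN A_carrier, of m] sA[THEN A_carrier, of n] tA[THEN A_carrier, of m]
        tA[THEN A_carrier, of n] by algebra
    moreover have "s m \<ominus> s n \<in> mpow N" "t m \<ominus> t n \<in> mpow N" using n that by auto
    ultimately show ?thesis using mpow_closed(3,4) sA tA by simp
  qed
  then show "\<exists>n0. \<forall>m\<ge>n0. \<forall>n\<ge>n0. s m \<otimes> t m \<ominus> s n \<otimes> t n \<in> mpow N" by blast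
qed

lemma cauchy_add:
  assumes "s \<in> cauchy" "t \<in> cauchy" shows "(\<lambda>n. s n \<oplus> t n) \<in> cauchy"
proof (rule cauchyI)
  note sA = cauchyD(1)[OF assms(1)] and tA = cauchyD(1)[OF assms(2)]
  show "s n \<oplus> t n \<in> A" for n using sA tA subringE(7)[OF subring] by blast
  fix N
  obtain n1 n2 where n: "\<forall>m\<ge>n1. \<forall>n\<ge>n1. s m \<ominus> s n \<in> mpow N" "\<forall>m\<ge>n2. \<forall>n\<ge>n2. t m \<ominus> t n \<in> mpow N"
    using cauchyD(2)[OF assms(1), of N] cauchyD(2)[OF assms(2), of N] by blast
  have "(s m \<oplus> t m) \<ominus> (s n \<oplus> t n) \<in> mpow N" if "m \<ge> max n1 n2" "n \<ge> max n1 n2" for m n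
  proof -
    have "(s m \<oplus> t m) \<ominus> (s n \<oplus> t n) = (s m \<ominus> s n) \<oplus> (t m \<ominus> t n)"
      using sA[THEN A_carrier, of m] sA[THEN A_carrier, of n] tA[THEN A_carrier, of m]
        tA[THEN A_carrier, of n] by algebra
    moreover have "s m \<ominus> s n \<in> mpow N" "t m \<ominus> t n \<in> mpow N" using n that by auto
    ultimately show ?thesis using mpow_closed(3) by simp
  qed
  then show "\<exists>n0. \<forall>m\<ge>n0. \<forall>n\<ge>n0. (s m \<oplus> t m) \<ominus> (s n \<oplus> t n) \<in> mpow N" by blast
qed

lemma cauchy_subring: "subring cauchy (seq_ring R)"
proof (rule ring.subringI)
  show "ring (seq_ring R)" using seq_ring_cring by (rule cring.axioms(1))
  show "\<one>\<^bsub>seq_ring R\<^esub> \<in> cauchy" using const_cauchy subringE(3)[OF subring] by simp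
  fix s assume s: "s \<in> cauchy"
  have "(\<lambda>n. \<ominus> \<one> \<otimes> s n) \<in> cauchy"
    using cauchy_mult[OF const_cauchy s] subringE(3,5)[OF subring] by simp
  moreover have "s n \<in> carrier R" for n using cauchyD(1)[OF s] A_carrier by blast
  ultimately show "\<ominus>\<^bsub>seq_ring R\<^esub> s \<in> cauchy"
    using s cauchy_carrier by (simp add: l_minus)
qed (use cauchy_carrier cauchy_mult cauchy_add in auto)

lemma null_ideal: "ideal null ((seq_ring R)\<lparr>carrier := cauchy\<rparr>)"
proof (rule cring.ideal_subringI[OF seq_ring_cring cauchy_subring])
  have nullD: "s \<in> null \<Longrightarrow> (\<forall>n. s n \<in> A) \<and> (\<forall>N. \<exists>n0. \<forall>n\<ge>n0. s n \<in> mpow N)" for s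
    by (simp add: null_seq_def)
  show "null \<subseteq> cauchy"
  proof (intro subsetI cauchyI)
    fix s N assume s: "s \<in> null"
    show "s n \<in> A" for n using nullD[OF s] by blast
    obtain n0 where "\<forall>n\<ge>n0. s n \<in> mpow N" using nullD[OF s] by blast
    then show "\<exists>n0. \<forall>m\<ge>n0. \<forall>n\<ge>n0. s m \<ominus> s n \<in> mpow N"
      using mpow_minus by blast
  qed
  show "\<zero>\<^bsub>seq_ring R\<^esub> \<in> null"
    using subringE(2)[OF subring] mpow_closed(2) by (auto simp: null_seq_def)
  fix s t
  assume t: "t \<in> null"
  {
    assume s: "s \<in> null"
    have "\<exists>n0. \<forall>n\<ge>n0. s n \<oplus> t n \<in> mpow N" for N
    proof -
      obtain n1 n2 where "\<forall>n\<ge>n1. s n \<in> mpow N" "\<forall>n\<ge>n2. t n \<in> mpow N"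
        using nullD[OF s] nullD[OF t] by blast
      then have "\<forall>n\<ge>max n1 n2. s n \<oplus> t n \<in> mpow N" using mpow_closed(3) by auto
      then show ?thesis by blast
    qed
    then show "s \<oplus>\<^bsub>seq_ring R\<^esub> t \<in> null"
      using nullD[OF s] nullD[OF t] subringE(7)[OF subring] by (auto simp: null_seq_def)
  next
    assume s: "s \<in> cauchy"
    have "\<exists>n0. \<forall>n\<ge>n0. s n \<otimes> t n \<in> mpow N" for N
      using nullD[OF t] cauchyD(1)[OF s] mpow_closed(4) by blast
    then show "s \<otimes>\<^bsub>seq_ring R\<^esub> t \<in> null"
      using nullD[OF t] cauchyD(1)[OF s] subringE(6)[OF subring] by (auto simp: null_seq_def)
  }
qed

end

lemma FactRing_carrier: "carrier (R Quot J) = {J +>\<^bsub>R\<^esub> a | a. a \<in> carrier R}"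
  by (auto simp: FactRing_def A_RCOSETS_def')


section \<open>Iterated quotients\<close>

text \<open>The next two definitions describe \<open>(R/N)/(P/N)\<close> through representatives in \<open>R\<close>. With \<open>R\<close> the ring
  of Cauchy sequences, \<open>N\<close> the null sequences and \<open>P\<close> the sequences of infinite value, \<^const>\<open>FactRing\<close>
  applied twice gives the quotient of the completion by its elements of infinite value.\<close>

definition quot_ideal :: "('a, 'b) ring_scheme \<Rightarrow> 'a set \<Rightarrow> 'a set \<Rightarrow> 'a set set" where
  "quot_ideal R N P = {f \<in> carrier (R Quot N). \<exists>s\<in>f. s \<in> P}"

definition quot_class :: "('a, 'b) ring_scheme \<Rightarrow> 'a set \<Rightarrow> 'a set \<Rightarrow> 'a \<Rightarrow> 'a set set" where
  "quot_class R N P s = quot_ideal R N P +>\<^bsub>R Quot N\<^esub> (N +>\<^bsub>R\<^esub> s)"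

context ring
begin

context
  fixes N P
  assumes N: "ideal N R" and P: "ideal P R" and NP: "N \<subseteq> P"
begin

lemma coset_mem_quot_ideal_iff:
  assumes a: "a \<in> carrier R"
  shows "N +> a \<in> quot_ideal R N P \<longleftrightarrow> a \<in> P"
proof
  interpret P: ideal P R by fact
  assume "N +> a \<in> quot_ideal R N P"
  then obtain s where s: "s \<in> N +> a" "s \<in> P" by (auto simp: quot_ideal_def)
  then obtain x where x: "x \<in> N" "s = x \<oplus> a" by (auto simp: a_r_coset_def')
  have "a = \<ominus> x \<oplus> s"
    using x a ideal.Icarr[OF N] by (simp add: r_neg1)
  moreover have "\<ominus> x \<in> P" using x NP by blast
  ultimately show "a \<in> P" using s(2) by simp
next
  assume "a \<in> P"
  moreover have "\<zero> \<oplus> a \<in> N +> a"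
    using additive_subgroup.zero_closed[OF ideal.axioms(1)[OF N]] unfolding a_r_coset_def' by blast
  ultimately show "N +> a \<in> quot_ideal R N P"
    using a by (auto simp: quot_ideal_def FactRing_carrier)
qed

lemma quot_ideal_ideal: "ideal (quot_ideal R N P) (R Quot N)"
proof -
  have "quot_ideal R N P = (+>) N ` P"
  proof
    show "quot_ideal R N P \<subseteq> (+>) N ` P"
    proof
      fix f assume f: "f \<in> quot_ideal R N P"
      then obtain a where "a \<in> carrier R" "f = N +> a" by (auto simp: quot_ideal_def FactRing_carrier)
      then show "f \<in> (+>) N ` P" using f coset_mem_quot_ideal_iff by simp
    qed
    show "(+>) N ` P \<subseteq> quot_ideal R N P"
      using coset_mem_quot_ideal_iff ideal.Icarr[OF P] by auto
  qed
  then show ?thesis using ring_ideal_imp_quot_ideal[OF N P] by simp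
qed

lemma quot_class_hom: "quot_class R N P \<in> ring_hom R (R Quot N Quot quot_ideal R N P)"
proof -
  have "quot_class R N P = ((+>\<^bsub>R Quot N\<^esub>) (quot_ideal R N P)) \<circ> ((+>) N)"
    by (auto simp: quot_class_def)
  then show ?thesis
    using ring_hom_trans[OF ideal.rcos_ring_hom[OF N] ideal.rcos_ring_hom[OF quot_ideal_ideal]]
    by simp
qed

lemma quot_class_surj:
  "carrier (R Quot N Quot quot_ideal R N P) = quot_class R N P ` carrier R"
  by (auto simp: FactRing_carrier quot_class_def)

lemma quot_class_eq_iff:
  assumes s: "s \<in> carrier R" and t: "t \<in> carrier R"
  shows "quot_class R N P s = quot_class R N P t \<longleftrightarrow> s \<ominus> t \<in> P"
proof -
  interpret Q: ring "R Quot N" using N by (rule ideal.quotient_is_ring)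
  interpret h: ring_hom_ring R "R Quot N" "(+>) N" using N by (rule ideal.rcos_ring_hom_ring)
  have "N +> s \<in> carrier (R Quot N)" "N +> t \<in> carrier (R Quot N)" using s t by auto
  then have "quot_class R N P s = quot_class R N P t \<longleftrightarrow>
      (N +> s) \<ominus>\<^bsub>R Quot N\<^esub> (N +> t) \<in> quot_ideal R N P"
    using Q.quotient_eq_iff_same_a_r_cos[OF quot_ideal_ideal] by (simp add: quot_class_def)
  also have "(N +> s) \<ominus>\<^bsub>R Quot N\<^esub> (N +> t) = N +> (s \<ominus> t)"
    using s t by (simp add: a_minus_def)
  finally show ?thesis using coset_mem_quot_ideal_iff s t by simp
qed

text \<open>The map between two such quotients is a union over the elements of a coset; this description of the
  elements serves to evaluate it.\<close>

lemma mem_quot_class_iff: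
  assumes s: "s \<in> carrier R"
  shows "f \<in> quot_class R N P s \<longleftrightarrow> (\<exists>t\<in>carrier R. t \<ominus> s \<in> P \<and> f = N +> t)"
proof -
  interpret Q: ring "R Quot N" using N by (rule ideal.quotient_is_ring)
  interpret I: ideal "quot_ideal R N P" "R Quot N" by (rule quot_ideal_ideal)
  have sc: "N +> s \<in> carrier (R Quot N)" using s by (auto simp: FactRing_carrier)
  show ?thesis
  proof
    assume f: "f \<in> quot_class R N P s"
    then have "f \<in> carrier (R Quot N)"
      using Q.a_r_coset_subset_G[OF I.a_subset sc] by (auto simp: quot_class_def)
    then obtain t where t: "t \<in> carrier R" "f = N +> t" by (auto simp: FactRing_carrier)
    have "quot_class R N P s = quot_class R N P t"
      using Q.a_repr_independence[OF _ sc I.a_subgroup] f t by (simp add: quot_class_def)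
    then show "\<exists>t\<in>carrier R. t \<ominus> s \<in> P \<and> f = N +> t" using t s quot_class_eq_iff by metis
  next
    assume "\<exists>t\<in>carrier R. t \<ominus> s \<in> P \<and> f = N +> t"
    then obtain t where t: "t \<in> carrier R" "t \<ominus> s \<in> P" "f = N +> t" by blast
    then have "f \<in> quot_class R N P t"
      using I.a_rcos_self by (auto simp: quot_class_def FactRing_carrier)
    then show "f \<in> quot_class R N P s" using t s quot_class_eq_iff by metis
  qed
qed

end

end

section \<open>Direct limits of quotients of subrings\<close>

text \<open>Rings \<open>A i\<close> that are images of an increasing family of subrings \<open>C i\<close> of one ring \<open>U\<close>, with
  transition maps induced by the inclusions and kernels cut out of \<open>C i\<close> by one set \<open>P\<close>. The limit
  is then the image of the union \<open>D\<close> of the \<open>C i\<close>, with kernel \<open>P\<close>. That \<open>P\<close> behaves like an ideal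
  on \<open>D\<close> is implicit, since it describes the kernels of ring homomorphisms.\<close>

locale dirlim_presentation = cring U for U :: "('u, 'v) ring_scheme" (structure) +
  fixes I :: "'i::order set" and A :: "'i \<Rightarrow> ('x, 'y) ring_scheme" and \<phi> :: "'i \<Rightarrow> 'i \<Rightarrow> 'x \<Rightarrow> 'x"
    and C :: "'i \<Rightarrow> 'u set" and q :: "'i \<Rightarrow> 'u \<Rightarrow> 'x" and P :: "'u set"
  assumes nonempty: "I \<noteq> {}"
    and directed: "\<And>i j. \<lbrakk>i \<in> I; j \<in> I\<rbrakk> \<Longrightarrow> \<exists>l\<in>I. i \<le> l \<and> j \<le> l"
    and C_subring: "\<And>i. i \<in> I \<Longrightarrow> subring (C i) U"
    and C_mono: "\<And>i j. \<lbrakk>i \<in> I; j \<in> I; i \<le> j\<rbrakk> \<Longrightarrow> C i \<subseteq> C j"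
    and q_hom: "\<And>i. i \<in> I \<Longrightarrow> q i \<in> ring_hom (U\<lparr>carrier := C i\<rparr>) (A i)"
    and q_surj: "\<And>i. i \<in> I \<Longrightarrow> carrier (A i) = q i ` C i"
    and q_compat: "\<And>i j s. \<lbrakk>i \<in> I; j \<in> I; i \<le> j; s \<in> C i\<rbrakk> \<Longrightarrow> \<phi> i j (q i s) = q j s"
    and q_eq_iff: "\<And>i s t. \<lbrakk>i \<in> I; s \<in> C i; t \<in> C i\<rbrakk> \<Longrightarrow> q i s = q i t \<longleftrightarrow> s \<ominus> t \<in> P"
begin

definition D where "D = (\<Union>i\<in>I. C i)"

text \<open>The class that \<^const>\<open>dirlim_class\<close> assigns to the image of \<open>s\<close>, written without reference to a
  stage at which \<open>s\<close> occurs.\<close>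

definition limit_class :: "'u \<Rightarrow> ('i \<times> 'x) set" where
  "limit_class s = {(j, b). j \<in> I \<and> (\<exists>t\<in>C j. b = q j t \<and> t \<ominus> s \<in> P)}"

lemma common_stage:
  assumes "finite S" "S \<subseteq> D" "finite J" "J \<subseteq> I"
  shows "\<exists>l\<in>I. S \<subseteq> C l \<and> (\<forall>j\<in>J. j \<le> l)"
proof -
  have J: "\<exists>l\<in>I. \<forall>j\<in>J. j \<le> l"
    using assms(3,4)
  proof (induction J)
    case empty
    then show ?case using nonempty by blast
  next
    case (insert j J)
    then obtain l where "l \<in> I" "\<forall>j\<in>J. j \<le> l" by auto
    moreover obtain l' where "l' \<in> I" "j \<le> l'" "l \<le> l'"
      using directed[of j l] insert.prems \<open>l \<in> I\<close> by auto
    ultimately show ?case by (intro bexI[of _ l']) (auto intro: order.trans)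
  qed
  show ?thesis
    using assms(1,2)
  proof (induction S)
    case empty
    then show ?case using J by blast
  next
    case (insert s S)
    then obtain l where l: "l \<in> I" "S \<subseteq> C l" "\<forall>j\<in>J. j \<le> l" by auto
    obtain i where i: "i \<in> I" "s \<in> C i" using insert.prems D_def by auto
    obtain l' where l': "l' \<in> I" "i \<le> l'" "l \<le> l'" using directed i l by blast
    then have "insert s S \<subseteq> C l'" using C_mono i l by blast
    moreover have "\<forall>j\<in>J. j \<le> l'" using l l' by (auto intro: order.trans)
    ultimately show ?case using l' by blast
  qed
qed

lemma dirlim_class_eq:
  assumes i: "i \<in> I" and s: "s \<in> C i"
  shows "dirlim_class I A \<phi> i (q i s) = limit_class s"
proof -
  have "(\<exists>k\<in>I. i \<le> k \<and> j \<le> k \<and> \<phi> i k (q i s) = \<phi> j k (q j t)) \<longleftrightarrow> t \<ominus> s \<in> P"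
    if j: "j \<in> I" and t: "t \<in> C j" for j t
  proof -
    have "\<phi> i k (q i s) = \<phi> j k (q j t) \<longleftrightarrow> t \<ominus> s \<in> P" if k: "k \<in> I" "i \<le> k" "j \<le> k" for k
    proof -
      have "s \<in> C k" "t \<in> C k" using C_mono k i j s t by blast+
      then show ?thesis using q_compat k i j s t q_eq_iff[of k t s] by auto
    qed
    then show ?thesis using directed[OF i j] by blast
  qed
  note iff = this
  show ?thesis
  proof (rule Set.set_eqI)
    fix z :: "'i \<times> 'x"
    obtain j b where z: "z = (j, b)" by (cases z)
    have "z \<in> dirlim_class I A \<phi> i (q i s) \<longleftrightarrow>
        j \<in> I \<and> (\<exists>t\<in>C j. b = q j t \<and> (\<exists>k\<in>I. i \<le> k \<and> j \<le> k \<and> \<phi> i k (q i s) = \<phi> j k (q j t)))"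
      unfolding z dirlim_class_def using q_surj[of j] by fast
    also have "\<dots> \<longleftrightarrow> z \<in> limit_class s"
      unfolding z limit_class_def using iff[of j] by (simp cong: conj_cong bex_cong)
    finally show "z \<in> dirlim_class I A \<phi> i (q i s) \<longleftrightarrow> z \<in> limit_class s" .
  qed
qed

lemma limit_class_eq_iff:
  assumes "s \<in> D" "t \<in> D"
  shows "limit_class s = limit_class t \<longleftrightarrow> s \<ominus> t \<in> P"
proof -
  obtain i where i: "i \<in> I" "s \<in> C i" "t \<in> C i"
    using common_stage[of "{s, t}" "{}"] assms by auto
  show ?thesis
  proof
    assume "limit_class s = limit_class t"
    moreover have "(i, q i s) \<in> limit_class s"
      using i q_eq_iff[of i s s] by (auto simp: limit_class_def)
    ultimately obtain t' where "t' \<in> C i" "q i s = q i t'" "t' \<ominus> t \<in> P"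
      by (auto simp: limit_class_def)
    then show "s \<ominus> t \<in> P" using q_eq_iff i by metis
  next
    assume "s \<ominus> t \<in> P"
    then have "q i s = q i t" using q_eq_iff i by simp
    then show "limit_class s = limit_class t" using dirlim_class_eq i by metis
  qed
qed

text \<open>The union that defines the operation is constant: replacing representatives of the operands and
  the stage does not change the result, because all of them agree at a later stage.\<close>

lemma dirlim_op_eq:
  assumes s: "s \<in> D" and t: "t \<in> D"
    and f: "\<And>k s t. \<lbrakk>k \<in> I; s \<in> C k; t \<in> C k\<rbrakk> \<Longrightarrow> g s t \<in> C k \<and> f k (q k s) (q k t) = q k (g s t)"
  shows "dirlim_op I A \<phi> f (limit_class s) (limit_class t) = limit_class (g s t)"
proof -
  have step: "dirlim_class I A \<phi> k (f k (\<phi> i k a) (\<phi> j k b)) = limit_class (g s t)"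
    if a: "(i, a) \<in> limit_class s" and b: "(j, b) \<in> limit_class t" and k: "k \<in> I" "i \<le> k" "j \<le> k" for i a j b k
  proof -
    obtain s' where s': "i \<in> I" "s' \<in> C i" "a = q i s'" "s' \<ominus> s \<in> P"
      using a unfolding limit_class_def by auto
    obtain t' where t': "j \<in> I" "t' \<in> C j" "b = q j t'" "t' \<ominus> t \<in> P"
      using b unfolding limit_class_def by auto
    have k': "s' \<in> C k" "t' \<in> C k" using C_mono k s' t' by blast+
    have "dirlim_class I A \<phi> k (f k (\<phi> i k a) (\<phi> j k b)) = limit_class (g s' t')"
      using f[OF k(1) k'] q_compat k s' t' dirlim_class_eq by simp
    also obtain l where l: "l \<in> I" "{s, t} \<subseteq> C l" "k \<le> l"
      using common_stage[of "{s, t}" "{k}"] s t k by auto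
    have l': "s' \<in> C l" "t' \<in> C l" using C_mono[OF k(1) l(1,3)] k' by blast+
    have "q l s' = q l s" "q l t' = q l t" using q_eq_iff l l' s' t' by auto
    then have "q l (g s' t') = q l (g s t)"
      using f[OF l(1) l'] f[of l s t] l by auto
    then have "limit_class (g s' t') = limit_class (g s t)"
      using dirlim_class_eq[OF l(1)] f[OF l(1) l'] f[of l s t] l by (metis insert_subset)
    finally show ?thesis .
  qed
  obtain i where i: "i \<in> I" "s \<in> C i" "t \<in> C i"
    using common_stage[of "{s, t}" "{}"] s t by auto
  have mem: "(i, q i s) \<in> limit_class s" "(i, q i t) \<in> limit_class t"
    using i q_eq_iff[of i s s] q_eq_iff[of i t t] by (auto simp: limit_class_def)
  show ?thesis
  proof
    show "dirlim_op I A \<phi> f (limit_class s) (limit_class t) \<subseteq> limit_class (g s t)"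
    proof
      fix z assume "z \<in> dirlim_op I A \<phi> f (limit_class s) (limit_class t)"
      then obtain i a j b k where
        "(i, a) \<in> limit_class s" "(j, b) \<in> limit_class t" "k \<in> I" "i \<le> k" "j \<le> k"
        and z: "z \<in> dirlim_class I A \<phi> k (f k (\<phi> i k a) (\<phi> j k b))"
        unfolding dirlim_op_def by auto
      then show "z \<in> limit_class (g s t)" using step[of i a j b k] by simp
    qed
    have "limit_class (g s t) = dirlim_class I A \<phi> i (f i (\<phi> i i (q i s)) (\<phi> i i (q i t)))"
      using step[OF mem] i(1) by simp
    also have "\<dots> \<subseteq> dirlim_op I A \<phi> f (limit_class s) (limit_class t)"
      unfolding dirlim_op_def
    proof
      fix z assume z: "z \<in> dirlim_class I A \<phi> i (f i (\<phi> i i (q i s)) (\<phi> i i (q i t)))"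
      show "z \<in> (\<Union>(i, a)\<in>limit_class s. \<Union>(j, b)\<in>limit_class t. \<Union>k\<in>{k \<in> I. i \<le> k \<and> j \<le> k}.
          dirlim_class I A \<phi> k (f k (\<phi> i k a) (\<phi> j k b)))"
        by (rule UN_I[OF mem(1)], simp only: prod.case, rule UN_I[OF mem(2)], simp only: prod.case,
            rule UN_I[of i]) (use i z in simp_all)
    qed
    finally show "limit_class (g s t) \<subseteq> dirlim_op I A \<phi> f (limit_class s) (limit_class t)" .
  qed
qed

lemma D_subring: "subring D U"
proof (rule subringI)
  obtain i where "i \<in> I" using nonempty by blast
  then show "\<one> \<in> D" using C_subring subringE(3) by (auto simp: D_def)
  show "D \<subseteq> carrier U" using subringE(1)[OF C_subring] unfolding D_def by (rule UN_least)
  show "\<ominus> s \<in> D" if "s \<in> D" for s using that subringE(5)[OF C_subring] unfolding D_def by blast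
  show "s \<otimes> t \<in> D" "s \<oplus> t \<in> D" if st: "s \<in> D" "t \<in> D" for s t
  proof -
    obtain i where i: "i \<in> I" "s \<in> C i" "t \<in> C i"
      using common_stage[of "{s, t}" "{}"] st by auto
    then show "s \<otimes> t \<in> D" "s \<oplus> t \<in> D"
      using subringE(6,7)[OF C_subring[OF i(1)] i(2,3)] i(1) unfolding D_def by blast+
  qed
qed

lemma limit_class_surj: "carrier (direct_limit I A \<phi>) = limit_class ` D"
proof -
  have "carrier (direct_limit I A \<phi>) = (\<Union>i\<in>I. dirlim_class I A \<phi> i ` carrier (A i))"
    by (auto simp: direct_limit_def)
  also have "\<dots> = (\<Union>i\<in>I. dirlim_class I A \<phi> i ` q i ` C i)" using q_surj by simp
  also have "\<dots> = (\<Union>i\<in>I. limit_class ` C i)"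
    using dirlim_class_eq by (simp add: image_image cong: image_cong_simp)
  finally show ?thesis by (simp add: D_def image_UN)
qed

lemma dirlim_const:
  assumes "\<And>i. i \<in> I \<Longrightarrow> c \<in> C i \<and> q i c = c' i"
  shows "(\<Union>i\<in>I. dirlim_class I A \<phi> i (c' i)) = limit_class c"
proof -
  have "dirlim_class I A \<phi> i (c' i) = limit_class c" if "i \<in> I" for i
    using dirlim_class_eq[of i c] assms[OF that] that by simp
  then show ?thesis using nonempty by simp
qed

lemma limit_class_hom: "limit_class \<in> ring_hom (U\<lparr>carrier := D\<rparr>) (direct_limit I A \<phi>)"
proof (rule ring_hom_memI)
  fix s t assume st: "s \<in> carrier (U\<lparr>carrier := D\<rparr>)" "t \<in> carrier (U\<lparr>carrier := D\<rparr>)"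
  show "limit_class s \<in> carrier (direct_limit I A \<phi>)" using st limit_class_surj by auto
  have "dirlim_op I A \<phi> (\<lambda>i. monoid.mult (A i)) (limit_class s) (limit_class t) = limit_class (s \<otimes> t)"
    using st ring_hom_memE(2)[OF q_hom] subringE(6)[OF C_subring] by (intro dirlim_op_eq) auto
  then show "limit_class (s \<otimes>\<^bsub>U\<lparr>carrier := D\<rparr>\<^esub> t) =
      limit_class s \<otimes>\<^bsub>direct_limit I A \<phi>\<^esub> limit_class t"
    by (simp add: direct_limit_def)
  have "dirlim_op I A \<phi> (\<lambda>i. ring.add (A i)) (limit_class s) (limit_class t) = limit_class (s \<oplus> t)"
    using st ring_hom_memE(3)[OF q_hom] subringE(7)[OF C_subring] by (intro dirlim_op_eq) auto
  then show "limit_class (s \<oplus>\<^bsub>U\<lparr>carrier := D\<rparr>\<^esub> t) =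
      limit_class s \<oplus>\<^bsub>direct_limit I A \<phi>\<^esub> limit_class t"
    by (simp add: direct_limit_def)
next
  show "limit_class \<one>\<^bsub>U\<lparr>carrier := D\<rparr>\<^esub> = \<one>\<^bsub>direct_limit I A \<phi>\<^esub>"
    using dirlim_const[of \<one> "\<lambda>i. \<one>\<^bsub>A i\<^esub>"] ring_hom_memE(4)[OF q_hom] subringE(3)[OF C_subring]
    by (simp add: direct_limit_def)
qed

lemma limit_class_zero:
  assumes "\<And>i. i \<in> I \<Longrightarrow> ring (A i)"
  shows "\<zero>\<^bsub>direct_limit I A \<phi>\<^esub> = limit_class \<zero>"
proof -
  have "q i \<zero> = \<zero>\<^bsub>A i\<^esub>" if "i \<in> I" for i
    using ring_hom_zero[OF q_hom[OF that] subring_is_ring[OF C_subring[OF that]] assms[OF that]]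
    by simp
  then show ?thesis
    using dirlim_const[of \<zero> "\<lambda>i. \<zero>\<^bsub>A i\<^esub>"] subringE(2)[OF C_subring]
    by (simp add: direct_limit_def)
qed

end

text \<open>Only total divisibility and primality of the kernel have to be checked upstairs, on representatives.\<close>

lemma (in cring) valuation_ring_imageI:
  assumes h: "h \<in> ring_hom R T" and surj: "carrier T = h ` carrier R" and zero: "\<zero>\<^bsub>T\<^esub> = h \<zero>"
    and "h \<one> \<noteq> h \<zero>"
    and integral: "\<And>s t. \<lbrakk>s \<in> carrier R; t \<in> carrier R; h (s \<otimes> t) = h \<zero>\<rbrakk> \<Longrightarrow> h s = h \<zero> \<or> h t = h \<zero>"
    and total: "\<And>s t. \<lbrakk>s \<in> carrier R; t \<in> carrier R\<rbrakk> \<Longrightarrow>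
      \<exists>w\<in>carrier R. h (s \<otimes> w) = h t \<or> h (t \<otimes> w) = h s"
  shows "valuation_ring T"
proof -
  have "T\<lparr>carrier := h ` carrier R, zero := h \<zero>\<rparr> = T" using surj zero by simp
  then interpret T: ring T using ring_hom_imp_img_ring[OF h] by simp
  note hom = ring_hom_memE[OF h]
  have comm: "x \<otimes>\<^bsub>T\<^esub> y = y \<otimes>\<^bsub>T\<^esub> x" if xy: "x \<in> carrier T" "y \<in> carrier T" for x y
  proof -
    obtain s t where "s \<in> carrier R" "t \<in> carrier R" "x = h s" "y = h t" using xy surj by auto
    then show ?thesis using hom(2)[of s t] hom(2)[of t s] m_comm[of s t] by simp
  qed
  interpret T: cring T
    by (intro cringI T.abelian_group_axioms T.monoid_comm_monoidI comm) (auto intro: T.l_distr)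
  have "domain T"
  proof (unfold_locales)
    show "\<one>\<^bsub>T\<^esub> \<noteq> \<zero>\<^bsub>T\<^esub>" using assms(4) zero hom(4) by simp
    fix x y assume xy: "x \<otimes>\<^bsub>T\<^esub> y = \<zero>\<^bsub>T\<^esub>" "x \<in> carrier T" "y \<in> carrier T"
    then obtain s t where st: "s \<in> carrier R" "t \<in> carrier R" "x = h s" "y = h t"
      using surj by auto
    then show "x = \<zero>\<^bsub>T\<^esub> \<or> y = \<zero>\<^bsub>T\<^esub>" using integral[of s t] xy(1) hom(2) zero by simp
  qed
  moreover have "x divides\<^bsub>T\<^esub> y \<or> y divides\<^bsub>T\<^esub> x" if xy: "x \<in> carrier T" "y \<in> carrier T" for x y
  proof -
    obtain s t where st: "s \<in> carrier R" "t \<in> carrier R" "x = h s" "y = h t" using xy surj by auto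
    then obtain w where "w \<in> carrier R" "h (s \<otimes> w) = h t \<or> h (t \<otimes> w) = h s" using total by blast
    then show ?thesis using st hom(1,2) unfolding factor_def by metis
  qed
  ultimately show ?thesis by (simp add: valuation_ring_def)
qed

section \<open>Value and maximal ideal in a directed system of local rings\<close>

text \<open>By \<open>1/u\<^sub>m - 1/u\<^sub>n = (u\<^sub>n - u\<^sub>m)/(u\<^sub>m u\<^sub>n)\<close>.\<close>

lemma (in local_subring) cauchy_inverse:
  assumes u: "u \<in> cauchy" and u': "\<And>n. u' n \<in> A" "\<And>n. u n \<otimes> u' n = \<one>"
  shows "u' \<in> cauchy"
proof (rule cauchyI)
  note uA = cauchyD(1)[OF u]
  fix N
  obtain n0 where n0: "\<forall>m\<ge>n0. \<forall>n\<ge>n0. u m \<ominus> u n \<in> mpow N" using cauchyD(2)[OF u] by blast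
  have "u' m \<ominus> u' n \<in> mpow N" if mn: "m \<ge> n0" "n \<ge> n0" for m n
  proof -
    have c: "u m \<in> carrier R" "u n \<in> carrier R" "u' m \<in> carrier R" "u' n \<in> carrier R"
      using uA u' A_carrier by auto
    have "(u' m \<otimes> u' n) \<otimes> (u n \<ominus> u m) = u' m \<otimes> (u n \<otimes> u' n) \<ominus> (u m \<otimes> u' m) \<otimes> u' n"
      using c by algebra
    also have "\<dots> = u' m \<ominus> u' n" unfolding u'(2) using c by simp
    finally show ?thesis
      using mpow_closed(4)[of "u' m \<otimes> u' n" "u n \<ominus> u m" N] n0 mn u'(1) subringE(6)[OF subring]
      by simp
  qed
  then show "\<exists>n0. \<forall>m\<ge>n0. \<forall>n\<ge>n0. u' m \<ominus> u' n \<in> mpow N" by blast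
qed (rule u')

text \<open>The multiples of a nonunit form a proper ideal, which lies in the only maximal ideal.\<close>

lemma (in local_subring) nonunit_in_mm:
  assumes noeth: "noetherian_ring (R\<lparr>carrier := A\<rparr>)"
    and x: "x \<in> A" "\<And>a. a \<in> A \<Longrightarrow> x \<otimes> a \<noteq> \<one>"
  shows "x \<in> \<mm>"
proof -
  interpret N: noetherian_ring "R\<lparr>carrier := A\<rparr>" by fact
  let ?J = "{x \<otimes> a | a. a \<in> A}"
  note xc = A_carrier[OF x(1)]
  have "ideal ?J (R\<lparr>carrier := A\<rparr>)"
  proof (rule ideal_subringI[OF subring])
    show "?J \<subseteq> A" using x(1) subringE(6)[OF subring] by auto
    have "\<zero> = x \<otimes> \<zero>" using xc by simp
    then show "\<zero> \<in> ?J" using subringE(2)[OF subring] by blast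
  next
    fix b d assume "b \<in> ?J" "d \<in> ?J"
    then obtain b' d' where b': "b = x \<otimes> b'" "d = x \<otimes> d'" "b' \<in> A" "d' \<in> A" by auto
    then have "b \<oplus> d = x \<otimes> (b' \<oplus> d')" using xc A_carrier by (simp add: r_distr)
    then show "b \<oplus> d \<in> ?J" using b' subringE(7)[OF subring] by blast
  next
    fix a b assume a: "a \<in> A" and "b \<in> ?J"
    then obtain b' where b': "b = x \<otimes> b'" "b' \<in> A" by auto
    then have "a \<otimes> b = x \<otimes> (a \<otimes> b')" using xc A_carrier a by (simp add: m_lcomm)
    then show "a \<otimes> b \<in> ?J" using a b' subringE(6)[OF subring] by blast
  qed
  moreover have "\<one> \<notin> ?J" using x(2) by fastforce
  then have "?J \<noteq> carrier (R\<lparr>carrier := A\<rparr>)" using subringE(3)[OF subring] by auto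
  ultimately obtain M where M: "maximalideal M (R\<lparr>carrier := A\<rparr>)" "?J \<subseteq> M"
    using N.proper_ideal_le_maximal by blast
  have "x = x \<otimes> \<one>" using xc by simp
  then have "x \<in> ?J" using subringE(3)[OF subring] by blast
  then show ?thesis using M maximal_unique by blast
qed

text \<open>The nonzero element of positive value is what the rank of \<open>V\<close> provides, and \<open>noetherian\<close> what being
  essentially of finite type provides.\<close>

locale local_ring_system = field K for K :: "('a, 'b) ring_scheme" (structure) +
  fixes V :: "'a set" and \<nu> :: "'a \<Rightarrow> ereal" and I :: "'i::order set" and R :: "'i \<Rightarrow> 'a set"
  assumes V: "valuation_ring_of K V"
    and \<nu>: "real_valuation_of K V \<nu>"
    and nontrivial: "\<exists>x\<in>carrier K. x \<noteq> \<zero> \<and> 0 < \<nu> x"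
    and nonempty: "I \<noteq> {}"
    and directed: "\<And>i j. \<lbrakk>i \<in> I; j \<in> I\<rbrakk> \<Longrightarrow> \<exists>l\<in>I. i \<le> l \<and> j \<le> l"
    and local: "\<And>i. i \<in> I \<Longrightarrow> local_subring K (R i)"
    and noetherian: "\<And>i. i \<in> I \<Longrightarrow> noetherian_ring (K\<lparr>carrier := R i\<rparr>)"
    and V_union: "V = (\<Union>i\<in>I. R i)"
    and domination: "\<And>i j. \<lbrakk>i \<in> I; j \<in> I; i < j\<rbrakk> \<Longrightarrow> dominates K (R j) (R i)"
begin

abbreviation \<mm> where "\<mm> i \<equiv> max_ideal (K\<lparr>carrier := R i\<rparr>)"
abbreviation mpow where "mpow i \<equiv> max_power (K\<lparr>carrier := R i\<rparr>)"
abbreviation cauchy where "cauchy i \<equiv> cauchy_seq (K\<lparr>carrier := R i\<rparr>)"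
abbreviation null where "null i \<equiv> null_seq (K\<lparr>carrier := R i\<rparr>)"

lemmas R_subring = local_subring.subring[OF local]
lemmas mpow_closed = local_subring.mpow_closed[OF local]

lemma R_carrier: "\<lbrakk>i \<in> I; x \<in> R i\<rbrakk> \<Longrightarrow> x \<in> carrier K"
  using subringE(1)[OF R_subring] by blast

lemma \<nu>_mult: "\<lbrakk>x \<in> carrier K; y \<in> carrier K\<rbrakk> \<Longrightarrow> \<nu> (x \<otimes> y) = \<nu> x + \<nu> y"
  and \<nu>_add: "\<lbrakk>x \<in> carrier K; y \<in> carrier K\<rbrakk> \<Longrightarrow> min (\<nu> x) (\<nu> y) \<le> \<nu> (x \<oplus> y)"
  and V_eq: "V = {x \<in> carrier K. 0 \<le> \<nu> x}"
  and \<nu>_zero: "\<nu> \<zero> = \<infinity>"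
  using \<nu> by (simp_all add: real_valuation_of_def)

lemma \<nu>_real:
  assumes "x \<in> carrier K" "x \<noteq> \<zero>" obtains r where "\<nu> x = ereal r"
  using \<nu> assms by (cases "\<nu> x") (auto simp: real_valuation_of_def)

lemma \<nu>_nonneg: "\<lbrakk>i \<in> I; x \<in> R i\<rbrakk> \<Longrightarrow> 0 \<le> \<nu> x"
  using V_union V_eq by blast

lemma \<nu>_one: "\<nu> \<one> = 0"
proof -
  obtain r where r: "\<nu> \<one> = ereal r" using \<nu>_real[of \<one>] by auto
  then show ?thesis using \<nu>_mult[of \<one> \<one>] by simp
qed

lemma \<nu>_inv:
  assumes "x \<in> carrier K" "x \<noteq> \<zero>" shows "\<nu> (inv x) = - \<nu> x"
proof -
  have u: "x \<in> Units K" using assms field_Units by simp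
  obtain r where r: "\<nu> x = ereal r" using \<nu>_real[OF assms] by auto
  have "\<nu> x + \<nu> (inv x) = 0" using \<nu>_mult[of x "inv x"] \<nu>_one u assms by simp
  then show ?thesis using r by (cases "\<nu> (inv x)") auto
qed

lemma R_mono: "\<lbrakk>i \<in> I; j \<in> I; i \<le> j\<rbrakk> \<Longrightarrow> R i \<subseteq> R j"
  using domination[of i j] by (cases "i = j") (auto simp: dominates_def)

lemma \<mm>_mono:
  assumes "i \<in> I" "j \<in> I" "i \<le> j" shows "\<mm> i \<subseteq> \<mm> j"
proof (cases "i = j")
  case False
  then have "\<mm> j \<inter> R i = \<mm> i" using domination[of i j] assms by (simp add: dominates_def less_le)
  then show ?thesis by blast
qed simp

lemma common_stage:
  assumes "i \<in> I" "finite S" "S \<subseteq> V"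
  shows "\<exists>l\<in>I. i \<le> l \<and> S \<subseteq> R l"
  using assms(2,3)
proof (induction S)
  case empty
  then show ?case using assms(1) by auto
next
  case (insert x S)
  then obtain l where l: "l \<in> I" "i \<le> l" "S \<subseteq> R l" by auto
  obtain j where j: "j \<in> I" "x \<in> R j" using insert.prems V_union by auto
  obtain l' where l': "l' \<in> I" "l \<le> l'" "j \<le> l'" using directed l j by blast
  then have "insert x S \<subseteq> R l'" using R_mono l j by blast
  moreover have "i \<le> l'" using l l' by (auto intro: order.trans)
  ultimately show ?case using l' by blast
qed

text \<open>An element of the maximal ideal with value zero would be a unit of \<open>V\<close>, hence a unit of some later
  \<open>R l\<close>, although domination keeps it in the maximal ideal there. Conversely, an element of positive
  value has no inverse of nonnegative value.\<close>

lemma max_ideal_eq: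
  assumes i: "i \<in> I"
  shows "\<mm> i = {x \<in> R i. 0 < \<nu> x}"
proof -
  interpret L: local_subring K "R i" using local[OF i] .
  have "0 < \<nu> x" if x: "x \<in> \<mm> i" for x
  proof (rule ccontr)
    assume "\<not> 0 < \<nu> x"
    have xR: "x \<in> R i" using ideal_subringE(1)[OF L.subring L.mm_ideal] x by blast
    then have xc: "x \<in> carrier K" and v: "\<nu> x = 0"
      using R_carrier[OF i] \<nu>_nonneg[OF i xR] \<open>\<not> 0 < \<nu> x\<close> by auto
    then have x0: "x \<noteq> \<zero>" using \<nu>_zero by auto
    then have u: "x \<in> Units K" using xc field_Units by simp
    then have "inv x \<in> V" using \<nu>_inv[OF xc x0] v by (simp add: V_eq)
    then obtain l where l: "l \<in> I" "i \<le> l" "inv x \<in> R l"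
      using common_stage[OF i, of "{inv x}"] by auto
    interpret M: local_subring K "R l" using local[OF l(1)] .
    have "inv x \<otimes> x \<in> \<mm> l"
      using ideal_subringE(4)[OF M.subring M.mm_ideal l(3)] \<mm>_mono[OF i l(1,2)] x by blast
    then show False using M.one_notin_mm u by simp
  qed
  moreover have "x \<in> \<mm> i" if x: "x \<in> R i" "0 < \<nu> x" for x
  proof (rule L.nonunit_in_mm[OF noetherian[OF i] x(1)], rule notI)
    fix a assume a: "a \<in> R i" "x \<otimes> a = \<one>"
    have "\<nu> x + \<nu> a = 0" using \<nu>_mult[of x a] a x R_carrier[OF i] \<nu>_one by simp
    then show False using x(2) \<nu>_nonneg[OF i a(1)]
      by (metis add_nonneg_eq_0_iff less_imp_le less_irrefl)
  qed
  ultimately show ?thesis using ideal_subringE(1)[OF L.subring L.mm_ideal] by blast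
qed

lemma inv_closed_if_value_zero:
  assumes i: "i \<in> I" and x: "x \<in> R i" "\<nu> x = 0"
  shows "inv x \<in> R i"
proof -
  have "x \<notin> \<mm> i" using max_ideal_eq[OF i] x by simp
  then obtain a where a: "a \<in> R i" "x \<otimes> a = \<one>"
    using local_subring.nonunit_in_mm[OF local[OF i] noetherian[OF i] x(1)] by blast
  then have "inv x = a" using x R_carrier[OF i] comm_inv_char by simp
  then show ?thesis using a by simp
qed

lemma mpow_mono: "\<lbrakk>i \<in> I; j \<in> I; i \<le> j\<rbrakk> \<Longrightarrow> mpow i n \<subseteq> mpow j n"
proof (induction n)
  case 0
  then show ?case using R_mono local_subring.mpow_0[OF local] by simp
next
  case (Suc n)
  note jS = local_subring.mpow_Suc[OF local[OF Suc.prems(2)]]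
  have "x \<in> mpow j (Suc n)" if "x \<in> mpow i n \<cdot>\<^bsub>K\<lparr>carrier := R i\<rparr>\<^esub> \<mm> i" for x
    using that
  proof (induction rule: ideal_prod.induct)
    case (prod a b)
    then have "a \<in> mpow j n" "b \<in> \<mm> j" using Suc \<mm>_mono by auto
    then show ?case
      unfolding jS using ideal_prod.prod[of a _ b _ "K\<lparr>carrier := R j\<rparr>"] by simp
  next
    case (sum a b)
    then show ?case using mpow_closed(3)[OF Suc.prems(2)] by simp
  qed
  then show ?case using local_subring.mpow_Suc[OF local[OF Suc.prems(1)]] by blast
qed

lemma cauchy_mono:
  assumes "i \<in> I" "j \<in> I" "i \<le> j" shows "cauchy i \<subseteq> cauchy j"
proof
  fix s assume s: "s \<in> cauchy i"
  note D = local_subring.cauchyD[OF local[OF assms(1)] s]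
  show "s \<in> cauchy j"
  proof (rule local_subring.cauchyI[OF local[OF assms(2)]])
    show "s n \<in> R j" for n using D(1) R_mono[OF assms] by auto
    show "\<exists>n0. \<forall>m\<ge>n0. \<forall>n\<ge>n0. s m \<ominus> s n \<in> mpow j N" for N
      using D(2)[of N] mpow_mono[OF assms, of N] by (meson subsetD)
  qed
qed

lemma null_mono:
  assumes "i \<in> I" "j \<in> I" "i \<le> j" shows "null i \<subseteq> null j"
proof
  fix s assume "s \<in> null i"
  then have s: "\<And>n. s n \<in> R i" "\<And>N. \<exists>n0. \<forall>n\<ge>n0. s n \<in> mpow i N" by (simp_all add: null_seq_def)
  have "\<exists>n0. \<forall>n\<ge>n0. s n \<in> mpow j N" for N
    using s(2)[of N] mpow_mono[OF assms, of N] by (meson subsetD)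
  then show "s \<in> null j" using s(1) R_mono[OF assms] by (auto simp: null_seq_def)
qed

text \<open>Here finite generation of the maximal ideal is essential: the minimum of finitely many positive
  values is still positive.\<close>

lemma value_lower_bound:
  assumes i: "i \<in> I"
  shows "\<exists>c>0. \<forall>n. \<forall>x\<in>mpow i n. ereal (real n * c) \<le> \<nu> x"
proof -
  interpret L: local_subring K "R i" using local[OF i] .
  interpret N: noetherian_ring "K\<lparr>carrier := R i\<rparr>" using noetherian[OF i] .
  obtain G where G: "G \<subseteq> R i" "finite G" "\<mm> i = Idl\<^bsub>K\<lparr>carrier := R i\<rparr>\<^esub> G"
    using N.finetely_gen[OF L.mm_ideal] by auto
  have "G \<subseteq> \<mm> i" using L.A.genideal_self[of G] G by simp
  then have pos: "\<forall>g\<in>G. 0 < \<nu> g" using max_ideal_eq[OF i] by blast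
  have "\<exists>c>0. \<forall>g\<in>G. ereal c \<le> \<nu> g"
    using G(2) pos
  proof (induction G)
    case empty
    show ?case by (intro exI[of _ 1]) simp
  next
    case (insert g G)
    then obtain c where c: "c > 0" "\<forall>g\<in>G. ereal c \<le> \<nu> g" by auto
    obtain d where d: "0 < ereal d" "ereal d < \<nu> g"
      using ereal_dense2[of 0 "\<nu> g"] insert.prems by auto
    show ?case
    proof (intro exI[of _ "min c d"] conjI ballI)
      show "0 < min c d" using c d by simp
      fix h assume "h \<in> insert g G"
      then consider "h = g" | "h \<in> G" by blast
      then show "ereal (min c d) \<le> \<nu> h"
      proof cases
        case 1
        have "ereal (min c d) \<le> ereal d" by simp
        also note less_imp_le[OF d(2)]
        finally show ?thesis using 1 by simp
      next
        case 2
        have "ereal (min c d) \<le> ereal c" by simp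
        also have "\<dots> \<le> \<nu> h" using 2 c(2) by blast
        finally show ?thesis .
      qed
    qed
  qed
  then obtain c where c: "c > 0" "\<And>g. g \<in> G \<Longrightarrow> ereal c \<le> \<nu> g" by blast
  let ?J = "{x \<in> R i. ereal c \<le> \<nu> x}"
  have "ideal ?J (K\<lparr>carrier := R i\<rparr>)"
  proof (rule ideal_subringI[OF L.subring])
    show "\<zero> \<in> ?J" using subringE(2)[OF L.subring] \<nu>_zero by simp
    show "a \<oplus> b \<in> ?J" if ab: "a \<in> ?J" "b \<in> ?J" for a b
    proof -
      have "ereal c \<le> min (\<nu> a) (\<nu> b)" using ab by simp
      also have "\<dots> \<le> \<nu> (a \<oplus> b)" using \<nu>_add ab R_carrier[OF i] by simp
      finally show ?thesis using ab subringE(7)[OF L.subring] by simp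
    qed
    show "a \<otimes> b \<in> ?J" if ab: "a \<in> R i" "b \<in> ?J" for a b
    proof -
      have "0 + ereal c \<le> \<nu> a + \<nu> b" using \<nu>_nonneg[OF i ab(1)] ab by (intro add_mono) auto
      also have "\<dots> = \<nu> (a \<otimes> b)" using \<nu>_mult ab R_carrier[OF i] by simp
      finally show ?thesis using ab subringE(6)[OF L.subring] by simp
    qed
  qed simp
  then have mJ: "\<mm> i \<subseteq> ?J" unfolding G(3) using L.A.genideal_minimal[of ?J G] G(1) c(2) by auto
  have "\<forall>x\<in>mpow i n. ereal (real n * c) \<le> \<nu> x" for n
  proof (induction n)
    case 0
    then show ?case using \<nu>_nonneg[OF i] L.mpow_0 by (simp add: zero_ereal_def[symmetric])
  next
    case (Suc n)
    have "x \<in> carrier K \<and> ereal (real (Suc n) * c) \<le> \<nu> x"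
      if "x \<in> mpow i n \<cdot>\<^bsub>K\<lparr>carrier := R i\<rparr>\<^esub> \<mm> i" for x
      using that
    proof (induction rule: ideal_prod.induct)
      case (prod a b)
      have ab: "a \<in> carrier K" "b \<in> carrier K" "ereal c \<le> \<nu> b"
        using prod mJ L.mpow_closed(1)[of n] R_carrier[OF i] by auto
      have "ereal (real (Suc n) * c) = ereal (real n * c) + ereal c"
        by (simp add: algebra_simps)
      also have "\<dots> \<le> \<nu> a + \<nu> b" using Suc prod(1) ab(3) by (intro add_mono) auto
      finally show ?case using \<nu>_mult ab by simp
    next
      case (sum a b)
      then have "ereal (real (Suc n) * c) \<le> min (\<nu> a) (\<nu> b)" by simp
      also have "\<dots> \<le> \<nu> (a \<oplus> b)" using \<nu>_add sum.IH by blast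
      finally show ?case using sum.IH by simp
    qed
    then show ?case using L.mpow_Suc by blast
  qed
  then show ?thesis using c(1) by blast
qed

text \<open>Dividing by \<open>a\<close> sends finitely many generators of the \<open>n\<close>th power into \<open>V\<close>, hence into one \<open>R l\<close>.
  The remaining factors of the \<open>(n + m)\<close>th power stay available, so that division by \<open>a\<close> preserves
  convergence and merely shifts it by \<open>n\<close>.\<close>

lemma divide_mpow:
  assumes i: "i \<in> I" and a: "a \<in> carrier K" "a \<noteq> \<zero>"
    and le: "\<And>x. x \<in> mpow i n \<Longrightarrow> \<nu> a \<le> \<nu> x"
  shows "\<exists>l\<in>I. i \<le> l \<and> (\<forall>m. \<forall>x\<in>mpow i (n + m). x \<otimes> inv a \<in> mpow l m)"
proof -
  interpret L: local_subring K "R i" using local[OF i] .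
  interpret N: noetherian_ring "K\<lparr>carrier := R i\<rparr>" using noetherian[OF i] .
  have ia: "inv a \<in> carrier K" using a field_Units by simp
  obtain r where r: "\<nu> a = ereal r" using \<nu>_real[OF a] by auto
  obtain G where G: "G \<subseteq> R i" "finite G" "mpow i n = Idl\<^bsub>K\<lparr>carrier := R i\<rparr>\<^esub> G"
    using N.finetely_gen[OF L.mpow_ideal[of n]] by auto
  have Gm: "G \<subseteq> mpow i n" using L.A.genideal_self[of G] G by simp
  have "g \<otimes> inv a \<in> V" if g: "g \<in> G" for g
  proof -
    have gc: "g \<in> carrier K" using g G(1) R_carrier[OF i] by blast
    have "\<nu> a \<le> \<nu> g" using le Gm g by blast
    then have "0 \<le> \<nu> g + \<nu> (inv a)" using \<nu>_inv[OF a] r by (cases "\<nu> g") auto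
    then show ?thesis using gc ia \<nu>_mult by (simp add: V_eq)
  qed
  then obtain l where l: "l \<in> I" "i \<le> l" "(\<lambda>g. g \<otimes> inv a) ` G \<subseteq> R l"
    using common_stage[OF i, of "(\<lambda>g. g \<otimes> inv a) ` G"] G(2) by auto
  interpret M: local_subring K "R l" using local[OF l(1)] .
  have RR: "R i \<subseteq> R l" using R_mono i l by blast
  let ?J = "{x \<in> R i. x \<otimes> inv a \<in> R l}"
  have "ideal ?J (K\<lparr>carrier := R i\<rparr>)"
  proof (rule ideal_subringI[OF L.subring])
    show "\<zero> \<in> ?J" using subringE(2)[OF L.subring] subringE(2)[OF M.subring] ia by simp
    show "x \<oplus> y \<in> ?J" if xy: "x \<in> ?J" "y \<in> ?J" for x y
      using xy subringE(7)[OF L.subring] subringE(7)[OF M.subring] R_carrier[OF i] ia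
      by (simp add: l_distr)
    show "x \<otimes> y \<in> ?J" if xy: "x \<in> R i" "y \<in> ?J" for x y
      using xy subringE(6)[OF L.subring] subringE(6)[OF M.subring] R_carrier[OF i] ia RR
      by (auto simp: m_assoc)
  qed simp
  then have mJ: "mpow i n \<subseteq> ?J" unfolding G(3) using L.A.genideal_minimal[of ?J G] G(1) l(3) by auto
  have "x \<otimes> inv a \<in> mpow l m \<and> x \<in> carrier K" if "x \<in> mpow i (n + m)" for m x
    using that unfolding L.mpow_add
  proof (induction rule: ideal_prod.induct)
    case (prod x y)
    have c: "x \<in> carrier K" "y \<in> carrier K"
      using prod L.mpow_closed(1)[of n] L.mpow_closed(1)[of m] R_carrier[OF i] by auto
    have "(x \<otimes> inv a) \<otimes> y \<in> mpow l m"
      using prod mJ mpow_mono[OF i l(1,2), of m] M.mpow_closed(4)[of "x \<otimes> inv a" y m] by auto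
    moreover have "(x \<otimes> y) \<otimes> inv a = (x \<otimes> inv a) \<otimes> y" using c ia by algebra
    ultimately show ?case using c by simp
  next
    case (sum x y)
    then show ?case using M.mpow_closed(3) ia by (simp add: l_distr)
  qed
  then show ?thesis using l by blast
qed

section \<open>Sequences of infinite value\<close>

text \<open>All real bounds are used, although \<^const>\<open>p_inf\<close> has those in the value group only; as the value
  group is unbounded, this is the same condition (\<open>P_iff\<close>).\<close>

definition P :: "(nat \<Rightarrow> 'a) set" where
  "P = {s. (\<forall>n. s n \<in> carrier K) \<and> (\<forall>r::real. \<exists>n0. \<forall>n\<ge>n0. ereal r < \<nu> (s n))}"

lemma value_group_unbounded: "\<exists>\<rho>\<in>value_group K \<nu>. r \<le> \<rho>"
proof -
  obtain x where x: "x \<in> carrier K" "x \<noteq> \<zero>" "0 < \<nu> x" using nontrivial by blast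
  obtain d where d: "\<nu> x = ereal d" using \<nu>_real x by blast
  have v: "x [^] n \<noteq> \<zero> \<and> \<nu> (x [^] n) = ereal (real n * d)" for n :: nat
  proof (induction n)
    case 0
    then show ?case using \<nu>_one by (simp add: zero_ereal_def)
  next
    case (Suc n)
    then show ?case using x \<nu>_mult d by (simp add: integral_iff algebra_simps)
  qed
  obtain n where "r < real n * d" using ex_less_of_nat_mult[of d r] x(3) d by auto
  moreover have "real n * d \<in> value_group K \<nu>"
    using v[of n] x(1) by (auto simp: value_group_def intro!: bexI[of _ "x [^] n"])
  ultimately show ?thesis by (intro bexI[of _ "real n * d"]) auto
qed

lemma P_iff:
  assumes "\<And>n. s n \<in> carrier K"
  shows "s \<in> P \<longleftrightarrow> (\<forall>\<rho>\<in>value_group K \<nu>. \<exists>n0. \<forall>n\<ge>n0. ereal \<rho> < \<nu> (s n))"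
proof
  assume R: "\<forall>\<rho>\<in>value_group K \<nu>. \<exists>n0. \<forall>n\<ge>n0. ereal \<rho> < \<nu> (s n)"
  have "\<exists>n0. \<forall>n\<ge>n0. ereal r < \<nu> (s n)" for r
  proof -
    obtain \<rho> where "\<rho> \<in> value_group K \<nu>" "r \<le> \<rho>" using value_group_unbounded by blast
    then obtain n0 where "\<forall>n\<ge>n0. ereal \<rho> < \<nu> (s n)" using R by blast
    moreover have "ereal r \<le> ereal \<rho>" using \<open>r \<le> \<rho>\<close> by simp
    ultimately show ?thesis by (meson le_less_trans)
  qed
  then show "s \<in> P" using assms by (simp add: P_def)
qed (auto simp: P_def)

lemma eventually_zero_P:
  assumes "\<And>n. s n \<in> carrier K" "\<And>n. n \<ge> n0 \<Longrightarrow> s n = \<zero>"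
  shows "s \<in> P"
proof -
  have "\<forall>n\<ge>n0. ereal r < \<nu> (s n)" for r using assms(2) \<nu>_zero by simp
  then show ?thesis using assms(1) unfolding P_def by blast
qed

lemma P_ideal:
  assumes i: "i \<in> I"
  shows "ideal (P \<inter> cauchy i) ((seq_ring K)\<lparr>carrier := cauchy i\<rparr>)"
proof -
  interpret L: local_subring K "R i" using local[OF i] .
  show ?thesis
  proof (rule cring.ideal_subringI[OF seq_ring_cring L.cauchy_subring])
    show "\<zero>\<^bsub>seq_ring K\<^esub> \<in> P \<inter> cauchy i"
      using subringE(2)[OF L.cauchy_subring] eventually_zero_P[of "\<lambda>n. \<zero>" 0] by simp
    fix s t
    assume t: "t \<in> P \<inter> cauchy i"
    then have tc: "t n \<in> carrier K" for n by (simp add: P_def)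
    {
      assume s: "s \<in> P \<inter> cauchy i"
      then have sc: "s n \<in> carrier K" for n by (simp add: P_def)
      have "\<exists>n0. \<forall>n\<ge>n0. ereal r < \<nu> (s n \<oplus> t n)" for r
      proof -
        obtain n1 n2 where n: "\<forall>n\<ge>n1. ereal r < \<nu> (s n)" "\<forall>n\<ge>n2. ereal r < \<nu> (t n)"
          using s t unfolding P_def by blast
        have "ereal r < \<nu> (s n \<oplus> t n)" if "n \<ge> max n1 n2" for n
        proof -
          have "ereal r < min (\<nu> (s n)) (\<nu> (t n))" using n that by simp
          also have "\<dots> \<le> \<nu> (s n \<oplus> t n)" using \<nu>_add[OF sc tc] .
          finally show ?thesis .
        qed
        then show ?thesis by blast
      qed
      then show "s \<oplus>\<^bsub>seq_ring K\<^esub> t \<in> P \<inter> cauchy i"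
        using s t sc tc L.cauchy_add by (auto simp: P_def)
    next
      assume s: "s \<in> cauchy i"
      then have sR: "s n \<in> R i" for n using L.cauchyD(1) by blast
      have "\<nu> (t n) \<le> \<nu> (s n \<otimes> t n)" for n
        using \<nu>_mult[OF R_carrier[OF i sR] tc] \<nu>_nonneg[OF i sR] add_mono[of 0 "\<nu> (s n)" "\<nu> (t n)"]
        by simp
      then have "\<exists>n0. \<forall>n\<ge>n0. ereal r < \<nu> (s n \<otimes> t n)" for r
        using t unfolding P_def by (blast intro: less_le_trans)
      then show "s \<otimes>\<^bsub>seq_ring K\<^esub> t \<in> P \<inter> cauchy i"
        using s t R_carrier[OF i sR] tc L.cauchy_mult by (auto simp: P_def)
    }
  qed simp
qed

lemma null_subset_P:
  assumes i: "i \<in> I" shows "null i \<subseteq> P \<inter> cauchy i"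
proof
  interpret L: local_subring K "R i" using local[OF i] .
  fix s assume s: "s \<in> null i"
  then have sc: "s \<in> cauchy i"
    using additive_subgroup.a_subset[OF ideal.axioms(1)[OF L.null_ideal]] by auto
  obtain c where c: "c > 0" "\<And>n x. x \<in> mpow i n \<Longrightarrow> ereal (real n * c) \<le> \<nu> x"
    using value_lower_bound[OF i] by blast
  have "\<exists>n0. \<forall>n\<ge>n0. ereal r < \<nu> (s n)" for r
  proof -
    obtain N where N: "r < real N * c" using ex_less_of_nat_mult[OF c(1), of r] by auto
    obtain n0 where "\<forall>n\<ge>n0. s n \<in> mpow i N" using s unfolding null_seq_def by blast
    then have "\<forall>n\<ge>n0. ereal (real N * c) \<le> \<nu> (s n)" using c(2) by blast
    moreover have "ereal r < ereal (real N * c)" using N by simp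
    ultimately show ?thesis by (meson less_le_trans)
  qed
  then show "s \<in> P \<inter> cauchy i"
    using sc L.cauchyD(1)[OF sc] R_carrier[OF i] by (auto simp: P_def)
qed

text \<open>An element of the completion with finite value is, at a later stage, a constant times a unit: the
  constant \<open>a\<close> is a term of the sequence so late that all further changes have larger value than \<open>a\<close>.\<close>

lemma unit_factorization:
  assumes i: "i \<in> I" and s: "s \<in> cauchy i" "s \<notin> P"
  shows "\<exists>l\<in>I. \<exists>a\<in>carrier K - {\<zero>}. \<exists>u\<in>cauchy l. \<exists>u'\<in>cauchy l. \<exists>n0.
    (\<forall>n. u n \<otimes> u' n = \<one>) \<and> (\<forall>n\<ge>n0. s n = a \<otimes> u n)"
proof -
  interpret L: local_subring K "R i" using local[OF i] .
  have sR: "s n \<in> R i" for n using L.cauchyD(1)[OF s(1)] .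
  have sK: "s n \<in> carrier K" for n using R_carrier[OF i sR] .
  obtain r where r: "\<And>n0. \<exists>n\<ge>n0. \<nu> (s n) \<le> ereal r"
    using s(2) sK by (auto simp: P_def not_less)
  obtain c where c: "c > 0" "\<And>n x. x \<in> mpow i n \<Longrightarrow> ereal (real n * c) \<le> \<nu> x"
    using value_lower_bound[OF i] by blast
  obtain N where N: "r < real N * c" using ex_less_of_nat_mult[OF c(1), of r] by auto
  obtain n0 where n0: "\<And>m n. \<lbrakk>m \<ge> n0; n \<ge> n0\<rbrakk> \<Longrightarrow> s m \<ominus> s n \<in> mpow i N"
    using L.cauchyD(2)[OF s(1)] by blast
  obtain n1 where n1: "n1 \<ge> n0" "\<nu> (s n1) \<le> ereal r" using r by blast
  define a where "a = s n1"
  have a: "a \<in> carrier K" "a \<noteq> \<zero>" using sK n1(2) \<nu>_zero by (auto simp: a_def)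
  have lt: "\<nu> a < \<nu> x" if x: "x \<in> mpow i N" for x
  proof -
    have "\<nu> a \<le> ereal r" using n1(2) by (simp add: a_def)
    also have "\<dots> < ereal (real N * c)" using N by simp
    also have "\<dots> \<le> \<nu> x" using c(2) x by blast
    finally show ?thesis .
  qed
  have aU: "a \<in> Units K" using a field_Units by simp
  obtain l where l: "l \<in> I" "i \<le> l"
    and div: "\<And>m x. x \<in> mpow i (N + m) \<Longrightarrow> x \<otimes> inv a \<in> mpow l m"
    using divide_mpow[OF i a, of N] lt by (meson less_imp_le)
  interpret M: local_subring K "R l" using local[OF l(1)] .
  \<comment> \<open>Early terms are replaced by \<open>\<one>\<close>, so that all terms of \<open>u\<close> are units of \<open>R l\<close>.\<close>
  define u where "u n = (if n < n1 then \<one> else s n \<otimes> inv a)" for n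
  have unit: "u n \<in> R l \<and> \<nu> (u n) = 0" for n
  proof (cases "n < n1")
    case True
    then show ?thesis using subringE(3)[OF M.subring] \<nu>_one by (simp add: u_def)
  next
    case False
    define z where "z = (s n \<ominus> a) \<otimes> inv a"
    have mem: "s n \<ominus> a \<in> mpow i N" using n0 n1(1) False by (simp add: a_def)
    then have zR: "z \<in> R l" using div[of "s n \<ominus> a" 0] M.mpow_0 by (simp add: z_def)
    have mK: "s n \<ominus> a \<in> carrier K" using sK a by simp
    have u_eq: "u n = \<one> \<oplus> z"
    proof -
      have "\<one> \<oplus> z = a \<otimes> inv a \<oplus> (s n \<ominus> a) \<otimes> inv a" using aU by (simp add: z_def)
      also have "\<dots> = s n \<otimes> inv a" using sK[of n] a(1) Units_inv_closed[OF aU] by algebra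
      finally show ?thesis using False by (simp add: u_def)
    qed
    obtain d where d: "\<nu> a = ereal d" using \<nu>_real[OF a] by blast
    have "0 < \<nu> z"
      using lt[OF mem] \<nu>_mult[OF mK Units_inv_closed[OF aU]] \<nu>_inv[OF a] d unfolding z_def
      by (cases "\<nu> (s n \<ominus> a)") auto
    then have zm: "z \<in> \<mm> l" using max_ideal_eq[OF l(1)] zR by simp
    have uR: "u n \<in> R l" using u_eq zR subringE(3,7)[OF M.subring] by simp
    have "u n \<notin> \<mm> l"
    proof
      assume "u n \<in> \<mm> l"
      then have "u n \<oplus> \<ominus> z \<in> \<mm> l" using ideal_subringE(3,5)[OF M.subring M.mm_ideal] zm by blast
      moreover have "u n \<oplus> \<ominus> z = \<one>" unfolding u_eq using R_carrier[OF l(1) zR] by algebra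
      ultimately show False using M.one_notin_mm by simp
    qed
    then show ?thesis using uR \<nu>_nonneg[OF l(1) uR] max_ideal_eq[OF l(1)] by auto
  qed
  have uK: "u n \<in> carrier K" "u n \<noteq> \<zero>" for n
    using unit[of n] R_carrier[OF l(1)] \<nu>_zero by auto
  have u_cauchy: "u \<in> cauchy l"
  proof (rule M.cauchyI)
    show "u n \<in> R l" for n using unit by blast
    fix m
    obtain n2 where n2: "\<And>p q. \<lbrakk>p \<ge> n2; q \<ge> n2\<rbrakk> \<Longrightarrow> s p \<ominus> s q \<in> mpow i (N + m)"
      using L.cauchyD(2)[OF s(1)] by blast
    have "u p \<ominus> u q \<in> mpow l m" if pq: "p \<ge> max n1 n2" "q \<ge> max n1 n2" for p q
    proof -
      have "(s p \<ominus> s q) \<otimes> inv a \<in> mpow l m" using div n2 pq by simp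
      moreover have "(s p \<ominus> s q) \<otimes> inv a = s p \<otimes> inv a \<ominus> s q \<otimes> inv a"
        using sK[of p] sK[of q] Units_inv_closed[OF aU] by algebra
      ultimately show ?thesis using pq by (simp add: u_def)
    qed
    then show "\<exists>n0. \<forall>p\<ge>n0. \<forall>q\<ge>n0. u p \<ominus> u q \<in> mpow l m" by blast
  qed
  moreover have "(\<lambda>n. inv (u n)) \<in> cauchy l"
    using M.cauchy_inverse[OF u_cauchy] inv_closed_if_value_zero[OF l(1)] unit uK field_Units
    by simp
  moreover have "\<forall>n. u n \<otimes> inv (u n) = \<one>" using uK field_Units by simp
  moreover have "s n = a \<otimes> u n" if "n \<ge> n1" for n
  proof -
    have "a \<otimes> (s n \<otimes> inv a) = s n \<otimes> (a \<otimes> inv a)"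
      using sK[of n] a(1) Units_inv_closed[OF aU] by algebra
    then show ?thesis using that sK aU by (simp add: u_def)
  qed
  ultimately show ?thesis
    using l(1) a
    by (intro bexI[of _ l] bexI[of _ a] bexI[of _ u] bexI[of _ "\<lambda>n. inv (u n)"] exI[of _ n1]) auto
qed

end

context local_ring_system
begin

section \<open>The limit of the completions modulo infinite value\<close>

text \<open>The residue class of a Cauchy sequence in the completion modulo the elements of infinite value.\<close>

definition q :: "'i \<Rightarrow> (nat \<Rightarrow> 'a) \<Rightarrow> (nat \<Rightarrow> 'a) set set" where
  "q i = quot_class ((seq_ring K)\<lparr>carrier := cauchy i\<rparr>) (null i) (P \<inter> cauchy i)"

lemma cauchy_ring_eq: "i \<in> I \<Longrightarrow> cauchy_ring (K\<lparr>carrier := R i\<rparr>) = (seq_ring K)\<lparr>carrier := cauchy i\<rparr>"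
  by (rule local_subring.cauchy_ring_eq[OF local])

lemmas cauchy_subring = local_subring.cauchy_subring[OF local]
lemmas null_ideal = local_subring.null_ideal[OF local]

lemma cauchy_is_ring: "i \<in> I \<Longrightarrow> ring ((seq_ring K)\<lparr>carrier := cauchy i\<rparr>)"
  using ring.subring_is_ring[OF cring.axioms(1)[OF seq_ring_cring] cauchy_subring] .

lemmas quot_facts = cauchy_is_ring null_ideal P_ideal null_subset_P

lemma p_inf_eq:
  assumes i: "i \<in> I"
  shows "p_inf K \<nu> (R i) =
    quot_ideal ((seq_ring K)\<lparr>carrier := cauchy i\<rparr>) (null i) (P \<inter> cauchy i)"
proof -
  interpret S: ring "(seq_ring K)\<lparr>carrier := cauchy i\<rparr>" using cauchy_is_ring[OF i] .
  have sub: "f \<subseteq> cauchy i" if f: "f \<in> carrier ((seq_ring K)\<lparr>carrier := cauchy i\<rparr> Quot null i)" for f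
  proof -
    obtain a where "a \<in> cauchy i" "f = null i +>\<^bsub>(seq_ring K)\<lparr>carrier := cauchy i\<rparr>\<^esub> a"
      using f by (auto simp: FactRing_carrier)
    then show ?thesis
      using S.a_r_coset_subset_G[of "null i" a] null_subset_P[OF i] by simp
  qed
  have "(\<exists>s\<in>f. \<forall>\<rho>\<in>value_group K \<nu>. \<exists>n0. \<forall>n\<ge>n0. ereal \<rho> < \<nu> (s n)) \<longleftrightarrow>
      (\<exists>s\<in>f. s \<in> P \<inter> cauchy i)"
    if f: "f \<in> carrier ((seq_ring K)\<lparr>carrier := cauchy i\<rparr> Quot null i)" for f
  proof (rule bex_cong[OF refl])
    fix s assume "s \<in> f"
    then have s: "s \<in> cauchy i" using sub[OF f] by blast
    then have "s n \<in> carrier K" for n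
      using local_subring.cauchyD(1)[OF local[OF i] s] R_carrier[OF i] by blast
    then show "(\<forall>\<rho>\<in>value_group K \<nu>. \<exists>n0. \<forall>n\<ge>n0. ereal \<rho> < \<nu> (s n)) \<longleftrightarrow> s \<in> P \<inter> cauchy i"
      using P_iff s by simp
  qed
  then show ?thesis
    unfolding p_inf_def quot_ideal_def completion_def cauchy_ring_eq[OF i] by blast
qed

lemma bar_completion_eq:
  assumes i: "i \<in> I"
  shows "bar_completion K \<nu> (R i) = (seq_ring K)\<lparr>carrier := cauchy i\<rparr> Quot null i Quot
    quot_ideal ((seq_ring K)\<lparr>carrier := cauchy i\<rparr>) (null i) (P \<inter> cauchy i)"
  unfolding bar_completion_def completion_def p_inf_eq[OF i] cauchy_ring_eq[OF i] ..

lemma cauchy_minus: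
  assumes i: "i \<in> I" and "s \<in> cauchy i" "t \<in> cauchy i"
  shows "s \<ominus>\<^bsub>(seq_ring K)\<lparr>carrier := cauchy i\<rparr>\<^esub> t = s \<ominus>\<^bsub>seq_ring K\<^esub> t"
    and "s \<ominus>\<^bsub>seq_ring K\<^esub> t \<in> cauchy i"
proof -
  interpret S: ring "(seq_ring K)\<lparr>carrier := cauchy i\<rparr>" using cauchy_is_ring[OF i] .
  show eq: "s \<ominus>\<^bsub>(seq_ring K)\<lparr>carrier := cauchy i\<rparr>\<^esub> t = s \<ominus>\<^bsub>seq_ring K\<^esub> t"
    using ring.a_minus_subring[OF cring.axioms(1)[OF seq_ring_cring] cauchy_subring[OF i] assms(2,3)] .
  show "s \<ominus>\<^bsub>seq_ring K\<^esub> t \<in> cauchy i"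
    using S.minus_closed[of s t] assms(2,3) unfolding eq by simp
qed

lemma q_eq_iff:
  assumes i: "i \<in> I" and "s \<in> cauchy i" "t \<in> cauchy i"
  shows "q i s = q i t \<longleftrightarrow> s \<ominus>\<^bsub>seq_ring K\<^esub> t \<in> P"
  unfolding q_def
  using ring.quot_class_eq_iff[OF quot_facts[OF i], of s t] cauchy_minus[OF assms] assms(2,3)
  by simp

text \<open>A null sequence in \<open>R i\<close> is a null sequence in \<open>R j\<close>, so all members of the coset yield the same
  coset.\<close>

lemma completion_map_coset:
  assumes ij: "i \<in> I" "j \<in> I" "i \<le> j" and t: "t \<in> cauchy i"
  shows "completion_map (K\<lparr>carrier := R j\<rparr>) (null i +>\<^bsub>(seq_ring K)\<lparr>carrier := cauchy i\<rparr>\<^esub> t) =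
    null j +>\<^bsub>(seq_ring K)\<lparr>carrier := cauchy j\<rparr>\<^esub> t"
proof -
  let ?Si = "(seq_ring K)\<lparr>carrier := cauchy i\<rparr>" and ?Sj = "(seq_ring K)\<lparr>carrier := cauchy j\<rparr>"
  interpret Sj: ring ?Sj using cauchy_is_ring[OF ij(2)] .
  interpret Ni: ideal "null i" ?Si using null_ideal[OF ij(1)] .
  interpret Nj: ideal "null j" ?Sj using null_ideal[OF ij(2)] .
  have tj: "t \<in> carrier ?Sj" using t cauchy_mono[OF ij] by auto
  have "null j +>\<^bsub>?Sj\<^esub> t' = null j +>\<^bsub>?Sj\<^esub> t" if t': "t' \<in> null i +>\<^bsub>?Si\<^esub> t" for t'
  proof -
    obtain x where "x \<in> null i" "t' = x \<oplus>\<^bsub>seq_ring K\<^esub> t" using t' by (auto simp: a_r_coset_def')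
    then have "t' \<in> null j +>\<^bsub>?Sj\<^esub> t" using null_mono[OF ij] by (auto simp: a_r_coset_def')
    then show ?thesis using Sj.a_repr_independence[OF _ tj Nj.a_subgroup] by simp
  qed
  moreover have "t \<in> null i +>\<^bsub>?Si\<^esub> t" using Ni.a_rcos_self t by simp
  ultimately show ?thesis unfolding completion_map_def cauchy_ring_eq[OF ij(2)] by blast
qed

lemma bar_map_q:
  assumes ij: "i \<in> I" "j \<in> I" "i \<le> j" and s: "s \<in> cauchy i"
  shows "bar_map K \<nu> (R j) (q i s) = q j s"
proof -
  let ?Si = "(seq_ring K)\<lparr>carrier := cauchy i\<rparr>" and ?Sj = "(seq_ring K)\<lparr>carrier := cauchy j\<rparr>"
  have mem: "f \<in> q i s \<longleftrightarrow>
      (\<exists>t\<in>cauchy i. t \<ominus>\<^bsub>seq_ring K\<^esub> s \<in> P \<and> f = null i +>\<^bsub>?Si\<^esub> t)" for f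
    unfolding q_def
    using ring.mem_quot_class_iff[OF quot_facts[OF ij(1)], of s f] cauchy_minus[OF ij(1) _ s] s
    by auto
  have val: "p_inf K \<nu> (R j) +>\<^bsub>completion (K\<lparr>carrier := R j\<rparr>)\<^esub>
      completion_map (K\<lparr>carrier := R j\<rparr>) f = q j s" if f: "f \<in> q i s" for f
  proof -
    obtain t where t: "t \<in> cauchy i" "t \<ominus>\<^bsub>seq_ring K\<^esub> s \<in> P" "f = null i +>\<^bsub>?Si\<^esub> t"
      using f mem by blast
    have "p_inf K \<nu> (R j) +>\<^bsub>completion (K\<lparr>carrier := R j\<rparr>)\<^esub>
        completion_map (K\<lparr>carrier := R j\<rparr>) f = q j t"
      unfolding t(3) completion_map_coset[OF ij t(1)] p_inf_eq[OF ij(2)] completion_def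
        cauchy_ring_eq[OF ij(2)] q_def quot_class_def ..
    also have "\<dots> = q j s" using q_eq_iff[OF ij(2)] t(1,2) s cauchy_mono[OF ij] by blast
    finally show ?thesis .
  qed
  have "s \<ominus>\<^bsub>seq_ring K\<^esub> s \<in> P" using q_eq_iff[OF ij(1) s s] by simp
  then have "q i s \<noteq> {}" using mem s by blast
  then show ?thesis unfolding bar_map_def using val by simp
qed

sublocale T: dirlim_presentation "seq_ring K" I "\<lambda>i. bar_completion K \<nu> (R i)"
  "\<lambda>i j. bar_map K \<nu> (R j)" cauchy q P
proof (intro dirlim_presentation.intro seq_ring_cring dirlim_presentation_axioms.intro)
  fix i assume i: "i \<in> I"
  show "q i \<in> ring_hom ((seq_ring K)\<lparr>carrier := cauchy i\<rparr>) (bar_completion K \<nu> (R i))"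
    unfolding q_def bar_completion_eq[OF i] by (rule ring.quot_class_hom[OF quot_facts[OF i]])
  show "carrier (bar_completion K \<nu> (R i)) = q i ` cauchy i"
    unfolding q_def bar_completion_eq[OF i]
    using ring.quot_class_surj[OF quot_facts[OF i]] by simp
qed (use nonempty directed cauchy_subring cauchy_mono q_eq_iff bar_map_q in auto)

lemma bar_completion_ring: "i \<in> I \<Longrightarrow> ring (bar_completion K \<nu> (R i))"
  using ideal.quotient_is_ring[OF ring.quot_ideal_ideal[OF quot_facts]] bar_completion_eq by simp

lemma limit_class_eq_zero_iff:
  assumes "s \<in> T.D"
  shows "T.limit_class s = T.limit_class \<zero>\<^bsub>seq_ring K\<^esub> \<longleftrightarrow> s \<in> P"
proof -
  have z: "\<zero>\<^bsub>seq_ring K\<^esub> \<in> T.D" using subringE(2)[OF T.D_subring] .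
  have c: "s \<in> carrier (seq_ring K)" using assms subringE(1)[OF T.D_subring] by blast
  then have "s \<ominus>\<^bsub>seq_ring K\<^esub> \<zero>\<^bsub>seq_ring K\<^esub> = s" by (simp add: a_minus_def)
  then show ?thesis using T.limit_class_eq_iff[OF assms z] by simp
qed

text \<open>The terms of \<open>u\<close> have value zero because they and their inverses have nonnegative value.\<close>

lemma limit_ring_factorization:
  assumes s: "s \<in> T.D" "s \<notin> P"
  obtains l a u u' n0 where "l \<in> I" "a \<in> carrier K" "a \<noteq> \<zero>" "u \<in> cauchy l" "u' \<in> cauchy l"
    "\<And>n. u n \<otimes> u' n = \<one>" "\<And>n. \<nu> (u n) = 0" "\<And>n. n \<ge> n0 \<Longrightarrow> s n = a \<otimes> u n"
proof -
  obtain i where i: "i \<in> I" "s \<in> cauchy i" using s(1) by (auto simp: T.D_def)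
  obtain l a u u' n0 where *: "l \<in> I" "a \<in> carrier K" "a \<noteq> \<zero>" "u \<in> cauchy l" "u' \<in> cauchy l"
    "\<forall>n. u n \<otimes> u' n = \<one>" "\<forall>n\<ge>n0. s n = a \<otimes> u n"
    using unit_factorization[OF i s(2)] by blast
  have "\<nu> (u n) = 0" for n
  proof -
    have R: "u n \<in> R l" "u' n \<in> R l"
      using local_subring.cauchyD(1)[OF local[OF *(1)]] *(4,5) by auto
    have "\<nu> (u n) + \<nu> (u' n) = 0"
      using \<nu>_mult[of "u n" "u' n"] R R_carrier[OF *(1)] *(6) \<nu>_one by simp
    then show ?thesis
      using \<nu>_nonneg[OF *(1) R(1)] \<nu>_nonneg[OF *(1) R(2)] add_nonneg_eq_0_iff by blast
  qed
  then show ?thesis using that * by blast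
qed

text \<open>The product eventually has the finite value \<open>\<nu>(a) + \<nu>(b)\<close>, if \<open>a\<close> and \<open>b\<close> are the constants that
  belong to the two factors.\<close>

lemma P_prime:
  assumes s: "s \<in> T.D" "s \<notin> P" and t: "t \<in> T.D" "t \<notin> P"
  shows "(\<lambda>n. s n \<otimes> t n) \<notin> P"
proof
  assume P: "(\<lambda>n. s n \<otimes> t n) \<in> P"
  obtain l a u u' n1 where s': "l \<in> I" "a \<in> carrier K" "a \<noteq> \<zero>" "u \<in> cauchy l" "u' \<in> cauchy l"
    "\<And>n. u n \<otimes> u' n = \<one>" "\<And>n. \<nu> (u n) = 0" "\<And>n. n \<ge> n1 \<Longrightarrow> s n = a \<otimes> u n"
    using limit_ring_factorization[OF s] by blast
  obtain l' b v v' n2 where t': "l' \<in> I" "b \<in> carrier K" "b \<noteq> \<zero>" "v \<in> cauchy l'" "v' \<in> cauchy l'"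
    "\<And>n. v n \<otimes> v' n = \<one>" "\<And>n. \<nu> (v n) = 0" "\<And>n. n \<ge> n2 \<Longrightarrow> t n = b \<otimes> v n"
    using limit_ring_factorization[OF t] by blast
  have uv: "u n \<in> carrier K" "v n \<in> carrier K" for n
    using local_subring.cauchyD(1)[OF local[OF s'(1)] s'(4)] R_carrier[OF s'(1)]
      local_subring.cauchyD(1)[OF local[OF t'(1)] t'(4)] R_carrier[OF t'(1)] by auto
  obtain c d where cd: "\<nu> a = ereal c" "\<nu> b = ereal d" using \<nu>_real s'(2,3) t'(2,3) by metis
  have "\<nu> (s n \<otimes> t n) = ereal (c + d)" if "n \<ge> max n1 n2" for n
    using that s'(2,7,8) t'(2,7,8) uv cd by (simp add: \<nu>_mult)
  moreover obtain n0 where "\<forall>n\<ge>n0. ereal (c + d) < \<nu> (s n \<otimes> t n)" using P unfolding P_def by blast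
  ultimately show False by (metis less_irrefl max.cobounded1 max.cobounded2)
qed

text \<open>The quotient of \<open>t = b v\<close> by \<open>s = a u\<close> is \<open>w = (b/a) u\<^sup>-\<^sup>1 v\<close>, a Cauchy sequence at every stage that
  contains \<open>b/a\<close> and at which \<open>u\<^sup>-\<^sup>1\<close> and \<open>v\<close> are Cauchy.\<close>

lemma limit_class_divides:
  assumes l: "l \<in> I" and a: "a \<in> carrier K" "a \<noteq> \<zero>"
    and u: "u \<in> cauchy l" "u' \<in> cauchy l" "\<And>n. u n \<otimes> u' n = \<one>"
    and s: "s \<in> T.D" "\<And>n. n \<ge> n1 \<Longrightarrow> s n = a \<otimes> u n"
    and b: "b \<in> carrier K" and v: "l' \<in> I" "v \<in> cauchy l'"
    and t: "t \<in> T.D" "\<And>n. n \<ge> n2 \<Longrightarrow> t n = b \<otimes> v n"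
    and c: "inv a \<otimes> b \<in> V"
  shows "\<exists>w\<in>T.D. T.limit_class (s \<otimes>\<^bsub>seq_ring K\<^esub> w) = T.limit_class t"
proof -
  have ia: "inv a \<in> carrier K" "a \<otimes> inv a = \<one>" using a field_Units by simp_all
  define w where "w = (\<lambda>n. (inv a \<otimes> b) \<otimes> (u' n \<otimes> v n))"
  obtain j where j: "j \<in> I" "inv a \<otimes> b \<in> R j" using c V_union by auto
  obtain m where m: "m \<in> I" "l \<le> m" "l' \<le> m" "j \<le> m"
    using T.common_stage[of "{}" "{l, l', j}"] l v(1) j(1) by auto
  have c1: "(\<lambda>n. inv a \<otimes> b) \<in> cauchy m"
    using local_subring.const_cauchy[OF local[OF m(1)]] R_mono[OF j(1) m(1,4)] j(2) by blast
  have c2: "u' \<in> cauchy m" "v \<in> cauchy m"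
    using cauchy_mono[OF l m(1,2)] cauchy_mono[OF v(1) m(1,3)] u(2) v(2) by auto
  note mult = local_subring.cauchy_mult[OF local[OF m(1)]]
  have "w \<in> cauchy m" unfolding w_def by (rule mult[OF c1 mult[OF c2]])
  then have w: "w \<in> T.D" unfolding T.D_def using m(1) by blast
  have D: "x n \<in> carrier K" if "x \<in> T.D" for x n
  proof -
    have "x \<in> carrier (seq_ring K)" using that subringE(1)[OF T.D_subring] by blast
    then show ?thesis by simp
  qed
  have K: "u n \<in> carrier K" "u' n \<in> carrier K" "v n \<in> carrier K" for n
    using local_subring.cauchyD(1)[OF local[OF l] u(1)] R_carrier[OF l]
      local_subring.cauchyD(1)[OF local[OF l] u(2)]
      local_subring.cauchyD(1)[OF local[OF v(1)] v(2)] R_carrier[OF v(1)] by auto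
  have eq: "s n \<otimes> w n = t n" if n: "n \<ge> max n1 n2" for n
  proof -
    have "s n \<otimes> w n = (a \<otimes> u n) \<otimes> ((inv a \<otimes> b) \<otimes> (u' n \<otimes> v n))" using s(2) n by (simp add: w_def)
    also have "\<dots> = (a \<otimes> inv a) \<otimes> (u n \<otimes> u' n) \<otimes> (b \<otimes> v n)"
      using a(1) ia(1) b K[of n] by (simp add: m_ac)
    also have "\<dots> = b \<otimes> v n" unfolding ia(2) u(3) using b K[of n] by simp
    also have "\<dots> = t n" using t(2) n by simp
    finally show ?thesis .
  qed
  have sw: "s \<otimes>\<^bsub>seq_ring K\<^esub> w \<in> T.D" using subringE(6)[OF T.D_subring s(1) w] .
  have "(s \<otimes>\<^bsub>seq_ring K\<^esub> w) \<ominus>\<^bsub>seq_ring K\<^esub> t \<in> P"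
  proof (rule eventually_zero_P)
    show "((s \<otimes>\<^bsub>seq_ring K\<^esub> w) \<ominus>\<^bsub>seq_ring K\<^esub> t) n \<in> carrier K" for n
      using D[OF s(1)] D[OF w] D[OF t(1)] by simp
    show "((s \<otimes>\<^bsub>seq_ring K\<^esub> w) \<ominus>\<^bsub>seq_ring K\<^esub> t) n = \<zero>" if n: "n \<ge> max n1 n2" for n
      using D[OF s(1)] D[OF w] D[OF t(1)] eq[OF n] by (simp add: r_neg a_minus_def)
  qed
  then show ?thesis using T.limit_class_eq_iff[OF sw t(1)] w by blast
qed

lemma limit_class_total:
  assumes s: "s \<in> T.D" and t: "t \<in> T.D"
  shows "\<exists>w\<in>T.D. T.limit_class (s \<otimes>\<^bsub>seq_ring K\<^esub> w) = T.limit_class t \<or>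
    T.limit_class (t \<otimes>\<^bsub>seq_ring K\<^esub> w) = T.limit_class s"
proof -
  have z: "\<zero>\<^bsub>seq_ring K\<^esub> \<in> T.D" using subringE(2)[OF T.D_subring] .
  have sc: "s \<in> carrier (seq_ring K)" "t \<in> carrier (seq_ring K)"
    using s t subringE(1)[OF T.D_subring] by blast+
  consider "s \<in> P" | "t \<in> P" | "s \<notin> P" "t \<notin> P" by blast
  then show ?thesis
  proof cases
    case 1
    then have "T.limit_class (t \<otimes>\<^bsub>seq_ring K\<^esub> \<zero>\<^bsub>seq_ring K\<^esub>) = T.limit_class s"
      using limit_class_eq_zero_iff[OF s] T.r_null[OF sc(2)] by metis
    then show ?thesis using z by blast
  next
    case 2
    then have "T.limit_class (s \<otimes>\<^bsub>seq_ring K\<^esub> \<zero>\<^bsub>seq_ring K\<^esub>) = T.limit_class t"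
      using limit_class_eq_zero_iff[OF t] T.r_null[OF sc(1)] by metis
    then show ?thesis using z by blast
  next
    case 3
    obtain l a u u' n1 where s': "l \<in> I" "a \<in> carrier K" "a \<noteq> \<zero>" "u \<in> cauchy l" "u' \<in> cauchy l"
      "\<And>n. u n \<otimes> u' n = \<one>" "\<And>n. \<nu> (u n) = 0" "\<And>n. n \<ge> n1 \<Longrightarrow> s n = a \<otimes> u n"
      using limit_ring_factorization[OF s 3(1)] by blast
    obtain l' b v v' n2 where t': "l' \<in> I" "b \<in> carrier K" "b \<noteq> \<zero>" "v \<in> cauchy l'" "v' \<in> cauchy l'"
      "\<And>n. v n \<otimes> v' n = \<one>" "\<And>n. \<nu> (v n) = 0" "\<And>n. n \<ge> n2 \<Longrightarrow> t n = b \<otimes> v n"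
      using limit_ring_factorization[OF t 3(2)] by blast
    have cls: "inv a \<in> carrier K" "inv b \<in> carrier K" using s'(2,3) t'(2,3) field_Units by simp_all
    obtain c d where cd: "\<nu> a = ereal c" "\<nu> b = ereal d" using \<nu>_real s'(2,3) t'(2,3) by metis
    have "\<nu> (inv a \<otimes> b) = ereal (d - c)" "\<nu> (inv b \<otimes> a) = ereal (c - d)"
      using \<nu>_mult \<nu>_inv s'(2,3) t'(2,3) cls cd by simp_all
    then have "inv a \<otimes> b \<in> V \<or> inv b \<otimes> a \<in> V"
      using cls s'(2) t'(2) by (cases "c \<le> d") (auto simp: V_eq)
    then show ?thesis
    proof
      assume "inv a \<otimes> b \<in> V"
      from limit_class_divides[OF s'(1-6) s s'(8) t'(2,1,4) t t'(8) this] show ?thesis by blast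
    next
      assume "inv b \<otimes> a \<in> V"
      from limit_class_divides[OF t'(1-6) t t'(8) s'(2,1,4) s s'(8) this] show ?thesis by blast
    qed
  qed
qed

theorem T_bar_valuation_ring: "valuation_ring (T_bar K \<nu> I R)"
proof -
  interpret D: cring "(seq_ring K)\<lparr>carrier := T.D\<rparr>"
    using T.subcringI'[OF T.D_subring] T.subcring_iff subringE(1)[OF T.D_subring] by blast
  note Dc = subringE[OF T.D_subring]
  show ?thesis
    unfolding T_bar_def
  proof (rule D.valuation_ring_imageI[OF T.limit_class_hom])
    show "carrier (direct_limit I (\<lambda>i. bar_completion K \<nu> (R i)) (\<lambda>i j. bar_map K \<nu> (R j))) =
        T.limit_class ` carrier ((seq_ring K)\<lparr>carrier := T.D\<rparr>)"
      using T.limit_class_surj by simp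
    show "\<zero>\<^bsub>direct_limit I (\<lambda>i. bar_completion K \<nu> (R i)) (\<lambda>i j. bar_map K \<nu> (R j))\<^esub> =
        T.limit_class \<zero>\<^bsub>(seq_ring K)\<lparr>carrier := T.D\<rparr>\<^esub>"
      using T.limit_class_zero[OF bar_completion_ring] by simp
    have "\<one>\<^bsub>seq_ring K\<^esub> \<notin> P"
    proof
      assume "\<one>\<^bsub>seq_ring K\<^esub> \<in> P"
      then have "\<exists>n0. \<forall>n\<ge>n0. ereal 0 < \<nu> \<one>" unfolding P_def by auto
      then show False using \<nu>_one by (auto simp: zero_ereal_def)
    qed
    then show "T.limit_class \<one>\<^bsub>(seq_ring K)\<lparr>carrier := T.D\<rparr>\<^esub> \<noteq>
        T.limit_class \<zero>\<^bsub>(seq_ring K)\<lparr>carrier := T.D\<rparr>\<^esub>"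
      using limit_class_eq_zero_iff[OF Dc(3)] by simp
  next
    fix s t
    assume st: "s \<in> carrier ((seq_ring K)\<lparr>carrier := T.D\<rparr>)" "t \<in> carrier ((seq_ring K)\<lparr>carrier := T.D\<rparr>)"
      "T.limit_class (s \<otimes>\<^bsub>(seq_ring K)\<lparr>carrier := T.D\<rparr>\<^esub> t) =
        T.limit_class \<zero>\<^bsub>(seq_ring K)\<lparr>carrier := T.D\<rparr>\<^esub>"
    then have D: "s \<in> T.D" "t \<in> T.D" by simp_all
    have "(\<lambda>n. s n \<otimes> t n) \<in> P" using limit_class_eq_zero_iff[OF Dc(6)[OF D]] st(3) by simp
    then show "T.limit_class s = T.limit_class \<zero>\<^bsub>(seq_ring K)\<lparr>carrier := T.D\<rparr>\<^esub> \<or>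
        T.limit_class t = T.limit_class \<zero>\<^bsub>(seq_ring K)\<lparr>carrier := T.D\<rparr>\<^esub>"
      using P_prime[of s t] D limit_class_eq_zero_iff[OF D(1)] limit_class_eq_zero_iff[OF D(2)] by auto
  next
    fix s t
    assume st: "s \<in> carrier ((seq_ring K)\<lparr>carrier := T.D\<rparr>)" "t \<in> carrier ((seq_ring K)\<lparr>carrier := T.D\<rparr>)"
    then show "\<exists>w\<in>carrier ((seq_ring K)\<lparr>carrier := T.D\<rparr>).
        T.limit_class (s \<otimes>\<^bsub>(seq_ring K)\<lparr>carrier := T.D\<rparr>\<^esub> w) = T.limit_class t \<or>
        T.limit_class (t \<otimes>\<^bsub>(seq_ring K)\<lparr>carrier := T.D\<rparr>\<^esub> w) = T.limit_class s"
      using limit_class_total[of s t] by simp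
  qed
qed

end

text \<open>In a chain of two prime ideals, an element of the larger that is not in the smaller is neither zero
  nor a unit of \<open>V\<close>.\<close>

lemma (in field) krull_dim_pos_imp_nontrivial:
  assumes V: "valuation_ring_of R V" and \<nu>: "real_valuation_of R V \<nu>"
    and dim: "krull_dim (R\<lparr>carrier := V\<rparr>) > 0"
  shows "\<exists>x\<in>carrier R. x \<noteq> \<zero> \<and> 0 < \<nu> x"
proof -
  have sub: "subring V R" using V by (simp add: valuation_ring_of_def)
  obtain n Q where n: "enat n > 0" "\<And>i. i \<le> n \<Longrightarrow> primeideal (Q i) (R\<lparr>carrier := V\<rparr>)"
    "\<And>i. i < n \<Longrightarrow> Q i \<subset> Q (Suc i)"
    using dim unfolding krull_dim_def less_SUP_iff by auto
  have "n > 0" using n(1) by (simp add: zero_enat_def)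
  have id: "ideal (Q 0) (R\<lparr>carrier := V\<rparr>)" "ideal (Q 1) (R\<lparr>carrier := V\<rparr>)"
    and proper: "carrier (R\<lparr>carrier := V\<rparr>) \<noteq> Q 1"
    using primeideal.axioms(1)[OF n(2)[of 0]] primeideal.axioms(1)[OF n(2)[of 1]]
      primeideal.I_notcarr[OF n(2)[of 1]] \<open>n > 0\<close> by (simp_all add: Suc_le_eq)
  obtain x where x: "x \<in> Q 1" "x \<notin> Q 0" using n(3)[of 0] \<open>n > 0\<close> by auto
  have xV: "x \<in> V" using x(1) ideal_subringE(1)[OF sub id(2)] by blast
  have V_eq: "V = {x \<in> carrier R. 0 \<le> \<nu> x}" using \<nu> by (simp add: real_valuation_of_def)
  have x0: "x \<noteq> \<zero>" using x(2) ideal_subringE(2)[OF sub id(1)] by blast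
  have xc: "x \<in> carrier R" "0 \<le> \<nu> x" using xV V_eq by auto
  have u: "x \<in> Units R" using xc x0 field_Units by simp
  have "\<nu> x \<noteq> 0"
  proof
    assume v: "\<nu> x = 0"
    have mult: "\<nu> (a \<otimes> b) = \<nu> a + \<nu> b" if "a \<in> carrier R" "b \<in> carrier R" for a b
      using \<nu> that by (simp add: real_valuation_of_def)
    have "\<nu> (inv x) = 0"
      using mult[of x "inv x"] mult[of x \<one>] mult[of x x] v xc u by simp
    then have "inv x \<in> V" using V_eq u by simp
    then have "inv x \<otimes> x \<in> Q 1" using ideal_subringE(4)[OF sub id(2)] x(1) by blast
    then have "\<one> \<in> Q 1" using u by simp
    then show False using ideal.one_imp_carrier[OF id(2)] proper by simp
  qed
  then show ?thesis using xc x0 by (intro bexI[of _ x]) auto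
qed

theorem theorem7p3:
  fixes K :: "('a, 'b) ring_scheme" and k V :: "'a set" and \<nu> :: "'a \<Rightarrow> ereal"
    and I :: "'i::order set" and i0 :: 'i and R :: "'i \<Rightarrow> 'a set"
  assumes function_field: "algebraic_function_field K k"
    and char_zero: "\<forall>n::nat. n > 0 \<longrightarrow> [n] \<cdot>\<^bsub>K\<^esub> \<one>\<^bsub>K\<^esub> \<noteq> \<zero>\<^bsub>K\<^esub>"
    and V: "valuation_ring_of K V"
    and rank_one: "krull_dim (K\<lparr>carrier := V\<rparr>) = 1"
    and \<nu>: "real_valuation_of K V \<nu>"
    and directed: "\<forall>i\<in>I. \<forall>j\<in>I. \<exists>l\<in>I. i \<le> l \<and> j \<le> l"
    and minimum: "i0 \<in> I" "\<forall>i\<in>I. i0 \<le> i"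
    and local_rings: "\<forall>i\<in>I. subring (R i) K \<and> local_ring (K\<lparr>carrier := R i\<rparr>)"
    and normal: "\<forall>i\<in>I. normal_in K (R i)"
    and V_union: "V = (\<Union>i\<in>I. R i)"
    and finite_type: "\<forall>i\<in>I. ess_finite_type K k (R i)"
    and quotient_field: "\<forall>i\<in>I. quotient_field_is K (R i)"
    and domination: "\<forall>i\<in>I. \<forall>j\<in>I. i < j \<longrightarrow> dominates K (R j) (R i)"
  shows "valuation_ring (T_bar K \<nu> I R)"
proof -
  have k: "subfield k K" and "field K"
    using function_field by (simp_all add: algebraic_function_field_def)
  interpret field K by fact
  interpret local_ring_system K V \<nu> I R
  proof (intro local_ring_system.intro local_ring_system_axioms.intro)
    show "\<exists>x\<in>carrier K. x \<noteq> \<zero>\<^bsub>K\<^esub> \<and> 0 < \<nu> x"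
      using krull_dim_pos_imp_nontrivial[OF V \<nu>] rank_one by simp
    fix i assume i: "i \<in> I"
    show "local_subring K (R i)"
      using local_rings i by (intro local_subring.intro is_cring local_subring_axioms.intro) auto
    show "noetherian_ring (K\<lparr>carrier := R i\<rparr>)"
      using ess_finite_type_noetherian[OF k] local_rings finite_type i by blast
  qed (use V \<nu> minimum(1) directed V_union domination field_axioms in auto)
  show ?thesis by (rule T_bar_valuation_ring)
qed

end
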